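(* Every irreducible classical root system of rank $>2$ admits a $2$-good reduction to an irreducible classical root system of rank $2$.
   Context: A root system in a finite-dimensional real vector space $E$ is a finite non-empty subset $\Phi$ that spans $E$, does not contain $0$, and satisfies $\Phi=-\Phi$; its rank is $\dim E$. It is irreducible if it is not a disjoint union of two non-empty subsets whose $\mathbb{R}$-spans intersect trivially. A subsystem is a subset $\Psi$ with $\Psi=\Phi\cap\mathbb{R}\Psi$ ($\mathbb{R}\Psi$ the real span). $\Phi$ is regular if every root lies in an irreducible subsystem of rank $2$. $\Phi$ is classical if $E$ admits a Euclidean inner product with $\frac{2(\alpha,\beta)}{(\beta,\beta)}\in\mathbb{Z}$ and $\alpha-\frac{2(\alpha,\beta)}{(\beta,\beta)}\beta\in\Phi$ for all $\alpha,\beta\in\Phi$. (Classical systems need not be reduced; the irreducible classical ones of rank 2 are $A_2,B_2,BC_2,G_2$.) $\mathfrak{F}(\Phi)$ is the set of linear functionals $f:E\to\mathbb{R}$ with $f(\alpha)\ne0$ for all $\alpha\in\Phi$ and $f(\alpha)\neq f(\beta)$ for distinct $\alpha,\beta\in\Phi$; $\Phi_f=\{\alpha\in\Phi:f(\alpha)>0\}$. $\Phi_f,\Phi_g$ are co-maximal if $\Phi_h\supset\Phi_f\cap\Phi_g$ implies $\Phi_h=\Phi_f$ or $\Phi_h=\Phi_g$. The core of $\Phi_f$ is $C_f=\Phi_f\setminus\bigcup_g(\Phi_f\setminus\Phi_g)$, union over all $g$ with $\Phi_g$ co-maximal to $\Phi_f$. A reduction of $\Phi$ is a surjective linear map $\eta:\mathbb{R}\Phi\to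 V'$ onto a nonzero real vector space $V'$; with $\Phi'=\eta(\Phi)\setminus\{0\}$, $\eta$ is called a reduction of $\Phi$ to $\Phi'$. For $k\ge2$ the reduction $\eta$ is $k$-good if: (a) for any $\gamma\in\ker\eta\cap\Phi$ there is an irreducible regular subsystem $\Psi$ of $\Phi$ of rank $k$ with $\gamma\in\Psi$ and $\ker\eta\cap\Psi\subseteq\mathbb{R}\gamma$; (b) for any $f\in\mathfrak{F}(\Phi')$, $\gamma'\in C_f$ (core of $\Phi'_f$) and $\gamma\in\Phi$ with $\eta(\gamma)=\gamma'$, there are an irreducible subsystem $\Psi$ of $\Phi$ of rank $k$ and $g\in\mathfrak{F}(\Psi)$ such that $\gamma\in C_g$ (core of $\Psi_g$), $\eta(\Psi_g)\subseteq\Phi'_f$ and $\Psi\cap\eta^{-1}(\mathbb{R}\gamma')\subseteq\mathbb{R}\gamma$. *)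

theory Defs
  imports "HOL-Analysis.Analysis"
begin

text \<open>
  The ambient space \<open>E\<close> of a root system \<open>\<Phi>\<close> is not a separate parameter: since \<open>\<Phi>\<close> spans \<open>E\<close>,
  it is \<^term>\<open>span \<Phi>\<close>, a finite-dimensional subspace of a type of class \<^class>\<open>real_vector\<close>.
  In this way a subsystem is again a root system, in its own span.

  Linear functionals, bilinear forms and linear maps on \<^term>\<open>span \<Phi>\<close> are given by (non-unique)
  linear extensions to the whole type. Such extensions always exist, and all notions below
  depend only on the restriction to \<^term>\<open>span \<Phi>\<close>.
\<close>

definition root_system :: "'a::real_vector set \<Rightarrow> bool" where
  "root_system \<Phi> \<longleftrightarrow> finite \<Phi> \<and> \<Phi> \<noteq> {} \<and> 0 \<notin> \<Phi> \<and> \<Phi> = uminus ` \<Phi>"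

definition root_rank :: "'a::real_vector set \<Rightarrow> nat" where
  "root_rank \<Phi> = dim (span \<Phi>)"

definition irreducible_system :: "'a::real_vector set \<Rightarrow> bool" where
  "irreducible_system \<Phi> \<longleftrightarrow>
     \<not> (\<exists>A B. A \<noteq> {} \<and> B \<noteq> {} \<and> A \<inter> B = {} \<and> A \<union> B = \<Phi> \<and> span A \<inter> span B = {0})"

definition subsystem :: "'a::real_vector set \<Rightarrow> 'a set \<Rightarrow> bool" where
  "subsystem \<Psi> \<Phi> \<longleftrightarrow> \<Psi> = \<Phi> \<inter> span \<Psi>"

definition regular_system :: "'a::real_vector set \<Rightarrow> bool" where
  "regular_system \<Phi> \<longleftrightarrow>
     (\<forall>\<alpha>\<in>\<Phi>. \<exists>\<Psi>. subsystem \<Psi> \<Phi> \<and> irreducible_system \<Psi> \<and> root_rank \<Psi> = 2 \<and> \<alpha> \<in> \<Psi>)"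

definition inner_product_on :: "'a::real_vector set \<Rightarrow> ('a \<Rightarrow> 'a \<Rightarrow> real) \<Rightarrow> bool" where
  "inner_product_on E B \<longleftrightarrow>
     bilinear B \<and> (\<forall>x\<in>E. \<forall>y\<in>E. B x y = B y x) \<and> (\<forall>x\<in>E. x \<noteq> 0 \<longrightarrow> B x x > 0)"

definition classical_system :: "'a::real_vector set \<Rightarrow> bool" where
  "classical_system \<Phi> \<longleftrightarrow>
     (\<exists>B. inner_product_on (span \<Phi>) B \<and>
        (\<forall>\<alpha>\<in>\<Phi>. \<forall>\<beta>\<in>\<Phi>. 2 * B \<alpha> \<beta> / B \<beta> \<beta> \<in> \<int> \<and> \<alpha> - (2 * B \<alpha> \<beta> / B \<beta> \<beta>) *\<^sub>R \<beta> \<in> \<Phi>))"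

definition functionals :: "'a::real_vector set \<Rightarrow> ('a \<Rightarrow> real) set" where
  "functionals \<Phi> =
     {f. linear f \<and> (\<forall>\<alpha>\<in>\<Phi>. f \<alpha> \<noteq> 0) \<and> (\<forall>\<alpha>\<in>\<Phi>. \<forall>\<beta>\<in>\<Phi>. \<alpha> \<noteq> \<beta> \<longrightarrow> f \<alpha> \<noteq> f \<beta>)}"

definition positive_roots :: "'a::real_vector set \<Rightarrow> ('a \<Rightarrow> real) \<Rightarrow> 'a set" where
  "positive_roots \<Phi> f = {\<alpha>\<in>\<Phi>. f \<alpha> > 0}"

definition co_maximal :: "'a::real_vector set \<Rightarrow> ('a \<Rightarrow> real) \<Rightarrow> ('a \<Rightarrow> real) \<Rightarrow> bool" where
  "co_maximal \<Phi> f g \<longleftrightarrow>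
     (\<forall>h\<in>functionals \<Phi>. positive_roots \<Phi> f \<inter> positive_roots \<Phi> g \<subseteq> positive_roots \<Phi> h \<longrightarrow>
        positive_roots \<Phi> h = positive_roots \<Phi> f \<or> positive_roots \<Phi> h = positive_roots \<Phi> g)"

definition core :: "'a::real_vector set \<Rightarrow> ('a \<Rightarrow> real) \<Rightarrow> 'a set" where
  "core \<Phi> f = positive_roots \<Phi> f -
     (\<Union>g\<in>{g\<in>functionals \<Phi>. co_maximal \<Phi> f g}. positive_roots \<Phi> f - positive_roots \<Phi> g)"

text \<open>Surjectivity of a reduction onto its target space is built in: the target is
  \<^term>\<open>\<eta> ` span \<Phi>\<close>, which is also the span of \<open>\<Phi>'\<close>.\<close>

definition reduction :: "('a::real_vector \<Rightarrow> 'b::real_vector) \<Rightarrow> 'a set \<Rightarrow> 'b set \<Rightarrow> bool" where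
  "reduction \<eta> \<Phi> \<Phi>' \<longleftrightarrow> linear \<eta> \<and> \<eta> ` span \<Phi> \<noteq> {0} \<and> \<Phi>' = \<eta> ` \<Phi> - {0}"

definition good_reduction ::
  "nat \<Rightarrow> ('a::real_vector \<Rightarrow> 'b::real_vector) \<Rightarrow> 'a set \<Rightarrow> 'b set \<Rightarrow> bool" where
  "good_reduction k \<eta> \<Phi> \<Phi>' \<longleftrightarrow>
     k \<ge> 2 \<and> reduction \<eta> \<Phi> \<Phi>' \<and>
     (\<forall>\<gamma>\<in>\<Phi>. \<eta> \<gamma> = 0 \<longrightarrow>
        (\<exists>\<Psi>. subsystem \<Psi> \<Phi> \<and> irreducible_system \<Psi> \<and> regular_system \<Psi> \<and> root_rank \<Psi> = k \<and>
             \<gamma> \<in> \<Psi> \<and> {\<alpha>\<in>\<Psi>. \<eta> \<alpha> = 0} \<subseteq> span {\<gamma>})) \<and>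
     (\<forall>f\<in>functionals \<Phi>'. \<forall>\<gamma>'\<in>core \<Phi>' f. \<forall>\<gamma>\<in>\<Phi>. \<eta> \<gamma> = \<gamma>' \<longrightarrow>
        (\<exists>\<Psi>. subsystem \<Psi> \<Phi> \<and> irreducible_system \<Psi> \<and> root_rank \<Psi> = k \<and>
           (\<exists>g\<in>functionals \<Psi>. \<gamma> \<in> core \<Psi> g \<and>
              \<eta> ` positive_roots \<Psi> g \<subseteq> positive_roots \<Phi>' f \<and>
              \<Psi> \<inter> \<eta> -` span {\<gamma>'} \<subseteq> span {\<gamma>})))"

end

theory Submission
  imports Defs
begin

text \<open>
  The argument avoids the classification of root systems. Call a root long if no root is longer.
  Every root \<open>\<alpha>\<close> other than \<open>\<plusminus>\<theta>\<close> has \<open>2(\<alpha>,\<theta>)/(\<theta>,\<theta>) \<in> {-1, 0, 1}\<close> when \<open>\<theta>\<close> is long.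
  The reduction is given by a pair of orthogonal long roots \<open>\<theta>, \<phi>\<close> that are linked, meaning that some
  root is orthogonal to neither of them. Its two coordinates are \<open>2(x,\<theta>)/(\<theta>,\<theta>)\<close> and
  \<open>2(x,\<phi>)/(\<phi>,\<phi>)\<close>. The image consists of integral vectors of square norm \<open>1\<close>, \<open>2\<close> or \<open>4\<close>; it contains
  all those of norm \<open>2\<close> and \<open>4\<close>, and either all or none of those of norm \<open>1\<close>. So it is \<open>BC\<^sub>2\<close> or \<open>C\<^sub>2\<close>
  (\<open>pair_map_image\<close>, \<open>integral_shell_root_system\<close>).

  Linked pairs exist once the rank exceeds two (\<open>linked_exists\<close>). A long root and a non-orthogonal
  neighbour generate a string which either produces a linked pair at once or a second long root at
  60 degrees. In the latter case the long roots contain an \<open>A\<^sub>2\<close>, and a root outside the plane of this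
  \<open>A\<^sub>2\<close>, not orthogonal to it, yields a linked pair.

  For condition (a), a root \<open>\<gamma>\<close> of the kernel is not orthogonal to all the roots outside the kernel,
  because those are permuted by the reflections in kernel roots and \<open>\<Phi>\<close> is irreducible
  (\<open>kernel_root_linked\<close>). The plane through \<open>\<gamma>\<close> and such a root \<open>\<delta>\<close> meets the kernel in a line.

  For condition (b), choose signs and the order of \<open>\<theta>, \<phi>\<close> so that the functional is
  \<open>P x + Q y\<close> with \<open>P > Q > 0\<close>. The core then only contains vectors among \<open>(2,0), (1,0), (1,1)\<close>
  (\<open>integral_shell_core\<close>). Each root \<open>\<gamma>\<close> above one of these is a sum \<open>\<delta> + (\<gamma> - \<delta>)\<close> of two roots,
  where \<open>\<delta>\<close> lies above \<open>(1,-1)\<close> (\<open>linked_decomposition\<close>). The interesting case is \<open>(1,0)\<close>: the roots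
  above \<open>(1,-1)\<close> come in pairs \<open>\<delta>, \<theta> - \<phi> - \<delta>\<close>, and \<open>\<gamma>\<close> has positive product with the sum
  \<open>\<theta> - \<phi>\<close> of such a pair, hence with one of its members. Both summands are positive and have
  independent images, so the projection is injective on their plane, and in the system of roots in
  that plane the sum of two independent positive roots lies in the core (\<open>core_sum\<close>).
\<close>

section \<open>Functionals and cores\<close>

text \<open>
  A non-zero value \<open>g x\<close> or \<open>g x - g y\<close> excludes just one value of \<open>c\<close>, so a generic choice of \<open>c\<close>
  in any interval works.
\<close>

lemma functionals_perturb:
  fixes l u :: real
  assumes "finite S" "g \<in> functionals S" "linear k" "l < u"
  obtains c where "l < c" "c < u" "(\<lambda>x. k x + c * g x) \<in> functionals S"
proof -
  let ?F = "(\<lambda>x. - k x / g x) ` S \<union> (\<lambda>(x, y). - (k x - k y) / (g x - g y)) ` (S \<times> S)"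
  have "infinite ({l<..<u} - ?F)"
    using assms(1,4) by (intro Diff_infinite_finite) auto
  then obtain c where c: "c \<in> {l<..<u}" "c \<notin> ?F"
    using infinite_imp_nonempty by blast
  have g: "linear g" "\<And>x. x \<in> S \<Longrightarrow> g x \<noteq> 0" "\<And>x y. x \<in> S \<Longrightarrow> y \<in> S \<Longrightarrow> x \<noteq> y \<Longrightarrow> g x \<noteq> g y"
    using assms(2) by (auto simp: functionals_def)
  have "k x + c * g x \<noteq> 0" if "x \<in> S" for x
  proof
    assume "k x + c * g x = 0"
    then have "c = - k x / g x"
      using g(2)[OF that] by (simp add: field_simps)
    with c(2) that show False by blast
  qed
  moreover have "k x + c * g x \<noteq> k y + c * g y" if "x \<in> S" "y \<in> S" "x \<noteq> y" for x y
  proof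
    assume "k x + c * g x = k y + c * g y"
    then have "c = - (k x - k y) / (g x - g y)"
      using g(3)[OF that] by (simp add: field_simps)
    then have "c \<in> (\<lambda>(x, y). - (k x - k y) / (g x - g y)) ` (S \<times> S)"
      using that by (intro image_eqI[of _ _ "(x, y)"]) auto
    with c(2) show False by blast
  qed
  moreover have "linear (\<lambda>x. k x + c * g x)"
    using linear_compose_add[OF assms(3) linear_compose_scale_right[OF g(1), of c]] by simp
  ultimately show ?thesis
    using c(1) by (intro that[of c]) (simp_all add: functionals_def)
qed

lemma span_pairE:
  assumes "z \<in> span {x, y}"
  obtains a b where "z = a *\<^sub>R x + b *\<^sub>R y"
proof -
  obtain a where "z - a *\<^sub>R x \<in> span {y}" using assms span_breakdown_eq[of z x "{y}"] by auto
  then obtain b where "z - a *\<^sub>R x = b *\<^sub>R y" by (auto simp: span_singleton)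
  then show thesis using that[of a b] by (simp add: algebra_simps)
qed

text \<open>
  Suppose some co-maximal \<open>g'\<close> is negative on \<open>x + y\<close>. The functionals \<open>g' + c g\<close> with \<open>c > 0\<close> are
  positive wherever \<open>g\<close> and \<open>g'\<close> both are. As \<open>c\<close> grows, the values at \<open>x\<close>, \<open>y\<close> and \<open>x + y\<close> change
  sign at \<open>r x\<close>, \<open>r y\<close> and a mean of these two. If \<open>r x\<close> and \<open>r y\<close> differ, a \<open>c\<close> between the mean and
  the larger one separates the positive system both from that of \<open>g\<close> and from that of \<open>g'\<close>.
  If they agree, then \<open>g'\<close> is a negative multiple of \<open>g\<close> on the plane, the two positive systems are
  disjoint, and any functional with different signs on \<open>x\<close> and \<open>y\<close> contradicts co-maximality.
\<close>

lemma core_sum: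
  assumes "finite S" "g \<in> functionals S" "x \<in> S" "y \<in> S" "x + y \<in> S"
    and "S \<subseteq> span {x, y}" "independent {x, y}" "x \<noteq> y" "g x > 0" "g y > 0"
  shows "x + y \<in> core S g"
proof -
  have lg: "linear g" using assms(2) by (simp add: functionals_def)
  have pos: "x + y \<in> positive_roots S g"
    using assms(5,9,10) by (simp add: positive_roots_def linear_add[OF lg])
  have "x + y \<in> positive_roots S g'" if g': "g' \<in> functionals S" and co: "co_maximal S g g'" for g'
  proof (rule ccontr)
    assume no: "x + y \<notin> positive_roots S g'"
    have lg': "linear g'" using g' by (simp add: functionals_def)
    have "g' (x + y) \<noteq> 0" using g' assms(5) by (simp add: functionals_def)
    with no assms(5) have neg: "g' (x + y) < 0" by (simp add: positive_roots_def)
    \<comment> \<open>A functional positive on the intersection, but with \<open>a\<close> lost from the system of \<open>g\<close> and \<open>b\<close> gained over that of \<open>g'\<close>, contradicts co-maximality.\<close>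
    have contra: False
      if "a \<in> S" "g a > 0" "h a < 0" "b \<in> S" "g' b < 0" "h b > 0" "h \<in> functionals S"
        and sub: "\<And>z. z \<in> S \<Longrightarrow> g z > 0 \<Longrightarrow> g' z > 0 \<Longrightarrow> h z > 0" for a b h
    proof -
      have "positive_roots S g \<inter> positive_roots S g' \<subseteq> positive_roots S h"
        using sub by (auto simp: positive_roots_def)
      then have "positive_roots S h = positive_roots S g \<or> positive_roots S h = positive_roots S g'"
        using co that(7) by (simp add: co_maximal_def)
      moreover have "a \<in> positive_roots S g" "a \<notin> positive_roots S h"
        "b \<notin> positive_roots S g'" "b \<in> positive_roots S h"
        using that by (auto simp: positive_roots_def)
      ultimately show False by blast
    qed
    \<comment> \<open>The value of \<open>c\<close> at which \<open>g' + c g\<close> changes sign at \<open>z\<close>.\<close>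
    define r where "r z = - g' z / g z" for z
    have rg: "g' z = - r z * g z" if "g z > 0" for z
      using that by (simp add: r_def)
    show False
    proof (cases "r x = r y")
      case True
      have anti: "g' z = - r x * g z" if zS: "z \<in> S" for z
      proof -
        obtain c d where z: "z = c *\<^sub>R x + d *\<^sub>R y"
          using span_pairE[of z x y] zS assms(6) by blast
        show ?thesis
          using rg[OF assms(9)] rg[OF assms(10)] True
          by (simp add: z linear_add[OF lg] linear_add[OF lg'] linear_scale[OF lg] linear_scale[OF lg'] algebra_simps)
      qed
      have rpos: "r x > 0"
        using neg anti[OF assms(5)] pos by (simp add: positive_roots_def zero_less_mult_iff)
      obtain k :: "_ \<Rightarrow> real" where k: "linear k" "k x = 1" "k y = - 1"
        using linear_independent_extend[OF assms(7), of "\<lambda>z. if z = x then 1 else - 1 :: real"] assms(8) by auto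
      obtain c where c: "0 < c" "c < 1 / g y" "(\<lambda>z. k z + c * g z) \<in> functionals S"
        using functionals_perturb[OF assms(1,2) k(1), of 0 "1 / g y"] assms(10) by auto
      show False
      proof (rule contra[OF assms(4,10) _ assms(3) _ _ c(3)])
        show "k y + c * g y < 0" using c(2) assms(10) k by (simp add: field_simps)
        show "g' x < 0" using anti[OF assms(3)] rpos assms(9) by simp
        show "k x + c * g x > 0" using c(1) assms(9) k by (simp add: add_pos_pos)
        show "k z + c * g z > 0" if "z \<in> S" "g z > 0" "g' z > 0" for z
          using anti[OF that(1)] that rpos by (simp add: mult_less_0_iff)
      qed
    next
      case False
      have main: False if ab: "{a, b} = {x, y}" "r a < r b" for a b
      proof -
        have s: "a + b = x + y" "a \<in> S" "b \<in> S" "g a > 0" "g b > 0"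
          using ab assms by (auto simp: doubleton_eq_iff add.commute)
        let ?m = "r (a + b)"
        have gab: "g (a + b) = g a + g b" "g' (a + b) = - r a * g a - r b * g b"
          using rg[OF s(4)] rg[OF s(5)] by (simp_all add: linear_add[OF lg] linear_add[OF lg'])
        have "r a * g a < r b * g a" using ab(2) s(4) by simp
        then have "- g' (a + b) < r b * g (a + b)" by (simp add: gab distrib_left)
        then have mb: "?m < r b"
          unfolding r_def[of "a + b"] using s(4,5) gab(1) by (subst pos_divide_less_eq) auto
        have m0: "?m > 0" using neg s gab(1) by (simp add: r_def divide_neg_pos)
        obtain c where c: "?m < c" "c < r b" "(\<lambda>z. g' z + c * g z) \<in> functionals S"
          using functionals_perturb[OF assms(1,2) lg' mb] by auto
        show False
        proof (rule contra[OF s(3,5) _ _ _ _ c(3)])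
          show "g' b + c * g b < 0" using rg[OF s(5)] c(2) s(5) by simp
          show "a + b \<in> S" "g' (a + b) < 0" using s assms(5) neg by simp_all
          have gp: "g (a + b) > 0" using s gab by simp
          show "g' (a + b) + c * g (a + b) > 0" using rg[OF gp] c(1) gp by simp
          show "g' z + c * g z > 0" if "z \<in> S" "g z > 0" "g' z > 0" for z
            using that c(1) m0 by (simp add: add_pos_pos)
        qed
      qed
      show False using main[of x y] main[of y x] False by (cases "r x < r y") auto
    qed
  qed
  with pos show ?thesis by (auto simp: core_def)
qed

text \<open>
  If two positive systems differ only along a ray and its negative, every positive system
  containing their intersection is decided by the sign it gives to that ray. Hence the two are
  co-maximal. The hypothesis speaks of a ray and not of a single root because \<open>S\<close> may contain
  proportional roots.
\<close>

lemma not_in_core: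
  assumes "\<And>x. x \<in> S \<Longrightarrow> - x \<in> S" "f \<in> functionals S" "g \<in> functionals S" "g v < 0" "v \<in> S"
    and ray: "\<And>x. x \<in> S \<Longrightarrow> f x > 0 \<Longrightarrow> g x < 0 \<Longrightarrow> \<exists>c>0. x = c *\<^sub>R v"
  shows "v \<notin> core S f"
proof
  assume v: "v \<in> core S f"
  then have fv: "f v > 0" by (simp add: core_def positive_roots_def)
  have det: "positive_roots S h = positive_roots S k"
    if "\<And>x. x \<in> S \<Longrightarrow> k x > 0 \<Longrightarrow> h x > 0" "h \<in> functionals S" "k \<in> functionals S" for h k
  proof -
    have "k x > 0" if "x \<in> S" "h x > 0" for x
    proof (rule ccontr)
      assume "\<not> k x > 0"
      have l: "linear h" "linear k" "k x \<noteq> 0"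
        using \<open>h \<in> _\<close> \<open>k \<in> _\<close> \<open>x \<in> S\<close> by (auto simp: functionals_def)
      with \<open>\<not> k x > 0\<close> have "k (- x) > 0" by (simp add: linear_neg)
      then have "h (- x) > 0" using that assms(1) \<open>\<And>x. x \<in> S \<Longrightarrow> k x > 0 \<Longrightarrow> h x > 0\<close> by blast
      with that l show False by (simp add: linear_neg)
    qed
    with that(1) show ?thesis by (auto simp: positive_roots_def)
  qed
  have "co_maximal S f g"
    unfolding co_maximal_def
  proof (intro ballI impI)
    fix h assume h: "h \<in> functionals S"
      and sub: "positive_roots S f \<inter> positive_roots S g \<subseteq> positive_roots S h"
    have lh: "linear h" "linear f" "linear g" "h v \<noteq> 0"
      using h assms by (auto simp: functionals_def)
    have hp: "h x > 0" if "x \<in> S" "f x > 0" "g x > 0" for x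
      using sub that by (auto simp: positive_roots_def)
    have ng: "g x < 0 \<or> g x > 0" if "x \<in> S" for x
      using assms(3) that by (auto simp: functionals_def linorder_neq_iff)
    have nf: "f x < 0 \<or> f x > 0" if "x \<in> S" for x
      using assms(2) that by (auto simp: functionals_def linorder_neq_iff)
    consider "h v > 0" | "h v < 0" using lh by linarith
    then show "positive_roots S h = positive_roots S f \<or> positive_roots S h = positive_roots S g"
    proof cases
      case 1
      have "h x > 0" if "x \<in> S" "f x > 0" for x
        using ng[OF that(1)] hp[OF that] ray[OF that] 1 lh by (auto simp: linear_scale)
      then show ?thesis using det h assms(2) by blast
    next
      case 2
      have "h x > 0" if x: "x \<in> S" "g x > 0" for x
      proof (cases "f x > 0")
        case False
        then have "f (- x) > 0" "g (- x) < 0" using nf[OF x(1)] x lh by (auto simp: linear_neg)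
        then obtain c where c: "c > 0" "- x = c *\<^sub>R v" using ray assms(1) x by blast
        then have "h (- x) < 0" using 2 lh by (simp add: linear_scale mult_pos_neg)
        then show ?thesis using lh by (simp add: linear_neg)
      qed (use hp x in auto)
      then show ?thesis using det h assms(3) by blast
    qed
  qed
  with v assms(3,4) have "v \<notin> positive_roots S f - positive_roots S g" by (auto simp: core_def)
  with fv assms(4,5) show False by (simp add: positive_roots_def)
qed

section \<open>Roots in a plane\<close>

text \<open>
  Two of the three roots \<open>x\<close>, \<open>y\<close>, \<open>x + y\<close> fall into the same part of a decomposition, and any two of
  them span everything.
\<close>

lemma irreducible_span2:
  assumes "0 \<notin> S" "x \<in> S" "y \<in> S" "x + y \<in> S" "S \<subseteq> span {x, y}"
  shows "irreducible_system S"
  unfolding irreducible_system_def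
proof (clarify)
  fix A B assume *: "A \<noteq> {}" "B \<noteq> {}" "A \<inter> B = {}" "S = A \<union> B" "span A \<inter> span B = {0}"
  have False if xy: "x \<in> span U" "y \<in> span U" and U: "span U \<inter> span V = {0}" "V \<noteq> {}" "V \<subseteq> S" for U V
  proof -
    obtain v where v: "v \<in> V" using U by blast
    have "span {x, y} \<subseteq> span U" by (rule span_minimal) (use xy in auto)
    then have "v \<in> span U" using v U assms(5) by blast
    moreover have "v \<in> span V" using v by (rule span_base)
    ultimately have "v = 0" using U(1) by blast
    with v U(3) assms(1) show False by blast
  qed
  note no = this
  have two: "x \<in> span U \<and> y \<in> span U" if "x \<in> U \<and> y \<in> U \<or> x \<in> U \<and> x + y \<in> U \<or> y \<in> U \<and> x + y \<in> U" for U
  proof -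
    have "x = (x + y) - y" "y = (x + y) - x" by simp_all
    then show ?thesis using that span_base[of _ U] span_diff[of _ U] by metis
  qed
  have "(x \<in> span A \<and> y \<in> span A) \<or> (x \<in> span B \<and> y \<in> span B)"
    using two[of A] two[of B] assms(2-4) *(4) by blast
  then show False
    using no[of A B] no[of B A] * by blast
qed

text \<open>
  The source of all subsystems of rank two used below.
\<close>

lemma plane_subsystem:
  assumes "0 \<notin> S" "x \<in> S" "y \<in> S" "x + y \<in> S" "independent {x, y}" "x \<noteq> y"
  shows "subsystem (S \<inter> span {x, y}) S" "irreducible_system (S \<inter> span {x, y})"
    "root_rank (S \<inter> span {x, y}) = 2"
proof -
  have s: "span (S \<inter> span {x, y}) = span {x, y}"
  proof
    show "span (S \<inter> span {x, y}) \<subseteq> span {x, y}" by (rule span_minimal) auto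
    show "span {x, y} \<subseteq> span (S \<inter> span {x, y})"
      using assms by (intro span_mono) (auto intro: span_base)
  qed
  show "subsystem (S \<inter> span {x, y}) S" by (simp add: subsystem_def s)
  show "irreducible_system (S \<inter> span {x, y})"
    using assms by (intro irreducible_span2[of _ x y]) (auto intro: span_base span_add)
  show "root_rank (S \<inter> span {x, y}) = 2"
    using dim_span_eq_card_independent[OF assms(5)] assms(6) by (simp add: root_rank_def s span_span)
qed

text \<open>
  A non-vanishing determinant of two functionals shows that \<open>x\<close> and \<open>y\<close> are independent and that the
  two functionals separate the points of their plane.
\<close>

lemma independent_by_det:
  fixes p q :: "'a::real_vector \<Rightarrow> real"
  assumes "linear p" "linear q" "p x * q y \<noteq> p y * q x"
  shows "independent {x, y}" "x \<noteq> y"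
    and "z \<in> span {x, y} \<Longrightarrow> p z = 0 \<Longrightarrow> q z = 0 \<Longrightarrow> z = 0"
proof -
  have zero: "a = 0 \<and> b = 0" if "a * p x + b * p y = 0" "a * q x + b * q y = 0" for a b
  proof -
    have "a * (p x * q y - p y * q x) = q y * (a * p x + b * p y) - p y * (a * q x + b * q y)"
      by (simp add: right_diff_distrib distrib_left mult_ac)
    also have "\<dots> = 0" unfolding that by simp
    finally have "a * (p x * q y - p y * q x) = 0" .
    have "b * (p x * q y - p y * q x) = p x * (a * q x + b * q y) - q x * (a * p x + b * p y)"
      by (simp add: right_diff_distrib distrib_left mult_ac)
    also have "\<dots> = 0" unfolding that by simp
    finally have "b * (p x * q y - p y * q x) = 0" .
    with \<open>a * _ = 0\<close> show ?thesis using assms(3) by simp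
  qed
  show xy: "x \<noteq> y" using assms(3) by auto
  have comb: "p (a *\<^sub>R x + b *\<^sub>R y) = a * p x + b * p y" "q (a *\<^sub>R x + b *\<^sub>R y) = a * q x + b * q y" for a b
    by (simp_all add: linear_add[OF assms(1)] linear_add[OF assms(2)] linear_scale[OF assms(1)] linear_scale[OF assms(2)])
  show "z = 0" if z: "z \<in> span {x, y}" "p z = 0" "q z = 0" for z
  proof -
    obtain a b where ab: "z = a *\<^sub>R x + b *\<^sub>R y"
      using z(1) by (rule span_pairE)
    have "a = 0 \<and> b = 0" using zero[of a b] z(2,3) unfolding ab comb by blast
    then show ?thesis using ab by simp
  qed
  show "independent {x, y}"
  proof (rule independent_insertI)
    have "y \<noteq> 0" using assms by (auto simp: linear_0)
    then show "independent {y}" by simp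
    show "x \<notin> span {y}"
    proof
      assume "x \<in> span {y}"
      then obtain b where "x = b *\<^sub>R y" by (auto simp: span_singleton)
      then have "1 = (0::real)" using zero[of 1 "- b"] assms by (simp add: linear_scale)
      then show False by simp
    qed
  qed
qed

section \<open>The rank two systems of type C and BC\<close>

text \<open>
  For \<open>M = {2, 4}\<close> this is the root system \<open>C\<^sub>2\<close>, and for \<open>M = {1, 2, 4}\<close> it is \<open>BC\<^sub>2\<close>. The
  description by norms makes the invariance under reflections evident.
\<close>

definition integral_shell :: "real set \<Rightarrow> (real^2) set" where
  "integral_shell M = {v. v $ 1 \<in> \<int> \<and> v $ 2 \<in> \<int> \<and> v \<bullet> v \<in> M}"

lemma index2_cases:
  fixes i j :: 2
  assumes "i \<noteq> j"
  obtains "i = 1" "j = 2" | "i = 2" "j = 1"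
  using assms exhaust_2 by metis

lemma integral_shell_iff:
  fixes i j :: 2
  assumes "i \<noteq> j"
  shows "v \<in> integral_shell M \<longleftrightarrow> v $ i \<in> \<int> \<and> v $ j \<in> \<int> \<and> (v $ i)\<^sup>2 + (v $ j)\<^sup>2 \<in> M"
  using assms
  by (cases rule: index2_cases) (auto simp: integral_shell_def inner_vec_def sum_2 power2_eq_square add.commute)

lemma integral_norm_cases:
  fixes a b :: real
  assumes "a \<in> \<int>" "b \<in> \<int>" "a\<^sup>2 + b\<^sup>2 \<in> {1, 2, 4}"
  shows "(a, b) \<in> {(1,0), (-1,0), (0,1), (0,-1)} \<and> a\<^sup>2 + b\<^sup>2 = 1 \<or>
    (a, b) \<in> {(1,1), (1,-1), (-1,1), (-1,-1)} \<and> a\<^sup>2 + b\<^sup>2 = 2 \<or>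
    (a, b) \<in> {(2,0), (-2,0), (0,2), (0,-2)} \<and> a\<^sup>2 + b\<^sup>2 = 4"
proof -
  obtain m n where mn: "a = of_int m" "b = of_int n" using assms(1,2) by (auto elim!: Ints_cases)
  have "a\<^sup>2 + b\<^sup>2 \<le> 2\<^sup>2" using assms(3) by auto
  then have "a\<^sup>2 \<le> 2\<^sup>2" "b\<^sup>2 \<le> 2\<^sup>2" using zero_le_power2[of a] zero_le_power2[of b] by linarith+
  then have "\<bar>a\<bar> \<le> 2" "\<bar>b\<bar> \<le> 2" using abs_le_square_iff[of a 2] abs_le_square_iff[of b 2] by auto
  then have "\<bar>m\<bar> \<le> 2" "\<bar>n\<bar> \<le> 2" unfolding mn by linarith+
  then have "m \<in> {-2, -1, 0, 1, 2}" "n \<in> {-2, -1, 0, 1, 2}" by auto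
  then show ?thesis using assms(3) unfolding mn by (elim insertE emptyE) simp_all
qed

text \<open>
  Reflections preserve norms, so only integrality needs an argument: the factor \<open>2(u,v)/(v,v)\<close> is an
  integer for \<open>(v,v) \<le> 2\<close>, and for \<open>(v,v) = 4\<close> because then \<open>v\<close> is divisible by two.
\<close>

lemma integral_shell_root_system:
  assumes "{2, 4} \<subseteq> M" "M \<subseteq> {1, 2, 4}" "finite (integral_shell M)"
  shows "root_system (integral_shell M)" "irreducible_system (integral_shell M)"
    "classical_system (integral_shell M)" "root_rank (integral_shell M) = 2"
proof -
  let ?S = "integral_shell M"
  have mem: "v \<in> ?S \<longleftrightarrow> v $ 1 \<in> \<int> \<and> v $ 2 \<in> \<int> \<and> (v $ 1)\<^sup>2 + (v $ 2)\<^sup>2 \<in> M" for v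
    by (rule integral_shell_iff) simp
  have zero: "0 \<notin> ?S" using assms(2) by (auto simp: mem)
  have um: "- v \<in> ?S" if "v \<in> ?S" for v using that by (simp add: mem)
  let ?x = "vector [1, 1] :: real^2" and ?y = "vector [1, - 1] :: real^2"
  have xy: "?x \<in> ?S" "?y \<in> ?S" "?x + ?y \<in> ?S" using assms(1) by (auto simp: mem vector_2)
  have "?S = uminus ` ?S" using um by (auto intro: image_eqI[of _ uminus "- v" for v])
  then show "root_system ?S" using assms(3) zero xy(1) by (auto simp: root_system_def)
  have lin: "linear (\<lambda>v::real^2. v $ k)" for k by (intro linearI) simp_all
  have ind: "independent {?x, ?y}" "?x \<noteq> ?y"
    using independent_by_det(1,2)[OF lin[of 1] lin[of 2], of ?x ?y] by (simp_all add: vector_2)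
  have "v \<in> span {?x, ?y}" for v
  proof -
    have "v = ((v $ 1 + v $ 2) / 2) *\<^sub>R ?x + ((v $ 1 - v $ 2) / 2) *\<^sub>R ?y"
      by (simp add: vec_eq_iff forall_2 vector_2 field_simps)
    also have "\<dots> \<in> span {?x, ?y}" by (intro span_add span_scale) (auto intro: span_base)
    finally show ?thesis .
  qed
  then have "?S \<inter> span {?x, ?y} = ?S" by blast
  with plane_subsystem(2,3)[OF zero xy ind]
  show "irreducible_system ?S" "root_rank ?S = 2" by simp_all
  have inn: "u \<bullet> v = u $ 1 * v $ 1 + u $ 2 * v $ 2" for u v :: "real^2" by (simp add: inner_vec_def sum_2)
  have "inner_product_on (span ?S) (\<lambda>u v. u \<bullet> v)"
    by (auto simp: inner_product_on_def bilinear_def inner_commute inner_add inner_scaleR_right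
        intro!: linearI)
  moreover have "2 * (u \<bullet> v) / (v \<bullet> v) \<in> \<int> \<and> u - (2 * (u \<bullet> v) / (v \<bullet> v)) *\<^sub>R v \<in> ?S"
    if u: "u \<in> ?S" and v: "v \<in> ?S" for u v
  proof -
    let ?c = "2 * (u \<bullet> v) / (v \<bullet> v)"
    have uZ: "u $ 1 \<in> \<int>" "u $ 2 \<in> \<int>" and vZ: "v $ 1 \<in> \<int>" "v $ 2 \<in> \<int>"
      and N: "(v $ 1)\<^sup>2 + (v $ 2)\<^sup>2 \<in> {1, 2, 4}"
      using u v assms(2) unfolding mem by blast+
    have vv: "v \<bullet> v = (v $ 1)\<^sup>2 + (v $ 2)\<^sup>2" by (simp add: inn power2_eq_square)
    have c: "?c \<in> \<int>"
      using integral_norm_cases[OF vZ N] uZ unfolding vv by (auto simp: inn add_divide_distrib diff_divide_distrib)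
    moreover have "(u - ?c *\<^sub>R v) \<bullet> (u - ?c *\<^sub>R v) = u \<bullet> u"
    proof -
      have "?c * (v \<bullet> v) = 2 * (u \<bullet> v)" using N vv by auto
      moreover have "(u - c *\<^sub>R v) \<bullet> (u - c *\<^sub>R v) = u \<bullet> u + c * (c * (v \<bullet> v) - 2 * (u \<bullet> v))" for c
        by (simp add: inner_diff_left inner_diff_right inner_commute[of v u] algebra_simps)
      ultimately show ?thesis by simp
    qed
    moreover have "?c * v $ 1 \<in> \<int>" "?c * v $ 2 \<in> \<int>" using c vZ by (blast intro: Ints_mult)+
    ultimately have "u - ?c *\<^sub>R v \<in> ?S"
      using u uZ by (simp add: integral_shell_def)
    with c show ?thesis by blast
  qed
  ultimately show "classical_system ?S"
    unfolding classical_system_def by (intro exI[of _ "\<lambda>u v. u \<bullet> v"]) blast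
qed

lemma functionals_compose:
  assumes "f \<in> functionals S" "linear \<sigma>" "\<And>x. x \<in> S \<Longrightarrow> \<sigma> x \<in> S" "inj_on \<sigma> S"
  shows "(\<lambda>x. f (\<sigma> x)) \<in> functionals S"
proof -
  have f: "linear f" "\<And>x. x \<in> S \<Longrightarrow> f x \<noteq> 0" "\<And>x y. x \<in> S \<Longrightarrow> y \<in> S \<Longrightarrow> x \<noteq> y \<Longrightarrow> f x \<noteq> f y"
    using assms(1) by (auto simp: functionals_def)
  have "linear (\<lambda>x. f (\<sigma> x))" using linear_compose[OF assms(2) f(1)] by (simp add: o_def)
  moreover have "f (\<sigma> x) \<noteq> f (\<sigma> y)" if "x \<in> S" "y \<in> S" "x \<noteq> y" for x y
    using f(3) assms(3) that inj_onD[OF assms(4)] by metis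
  ultimately show ?thesis using f(2) assms(3) by (simp add: functionals_def)
qed

text \<open>
  The positive vectors are those among \<open>(2,0), (1,0), (1,1), (1,-1), (0,1), (0,2)\<close> that have norm in
  \<open>M\<close>. The last three are multiples of simple roots, and each is removed from the core by the
  corresponding simple reflection: negating \<open>Y\<close>, or exchanging \<open>X\<close> and \<open>Y\<close>.
\<close>

lemma integral_shell_core:
  fixes i j :: 2
  assumes "M \<subseteq> {1, 2, 4}" "f \<in> functionals (integral_shell M)" "v \<in> core (integral_shell M) f"
    and ij: "i \<noteq> j" and st: "s \<in> {1, - 1}" "t \<in> {1, - 1}"
    and f: "\<And>w. f w = P * (s * w $ i) + Q * (t * w $ j)" and PQ: "Q > 0" "P > Q"
  shows "(s * v $ i, t * v $ j) \<in> {(2, 0), (1, 0), (1, 1)}"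
proof -
  let ?S = "integral_shell M"
  define X where "X w = s * w $ i" for w :: "real^2"
  define Y where "Y w = t * w $ j" for w :: "real^2"
  have sq: "s * s = 1" "t * t = 1" using st by auto
  have all: "(\<forall>k. p k) \<longleftrightarrow> p i \<and> p j" for p
    using ij by (cases rule: index2_cases) (auto simp: forall_2)
  have eqI: "w = w' \<longleftrightarrow> X w = X w' \<and> Y w = Y w'" for w w'
    using st by (auto simp: vec_eq_iff all X_def Y_def)
  have mem: "w \<in> ?S \<longleftrightarrow> X w \<in> \<int> \<and> Y w \<in> \<int> \<and> (X w)\<^sup>2 + (Y w)\<^sup>2 \<in> M" for w
    using st by (auto simp: integral_shell_iff[OF ij] X_def Y_def)
  have fXY: "f w = P * X w + Q * Y w" for w by (simp add: f X_def Y_def)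
  have scaled: "X (c *\<^sub>R w) = c * X w" "Y (c *\<^sub>R w) = c * Y w" for c w
    by (simp_all add: X_def Y_def)
  have um: "- w \<in> ?S" if "w \<in> ?S" for w using that by (simp add: mem X_def Y_def)
  have cases: "(X w, Y w) \<in> {(1,0), (-1,0), (0,1), (0,-1), (1,1), (1,-1), (-1,1), (-1,-1),
      (2,0), (-2,0), (0,2), (0,-2)}" if "w \<in> ?S" for w
  proof -
    have "X w \<in> \<int>" "Y w \<in> \<int>" "(X w)\<^sup>2 + (Y w)\<^sup>2 \<in> {1, 2, 4}"
      using that assms(1) unfolding mem by blast+
    from integral_norm_cases[OF this] show ?thesis by (elim disjE conjE insertE emptyE) simp_all
  qed
  have vS: "v \<in> ?S" "f v > 0" using assms(3) by (auto simp: core_def positive_roots_def)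
  have "X v \<noteq> 0"
  proof
    assume X0: "X v = 0"
    define \<sigma> where "\<sigma> w = (\<chi> k. if k = j then - w $ k else w $ k)" for w :: "real^2"
    have s: "X (\<sigma> w) = X w" "Y (\<sigma> w) = - Y w" for w using ij by (simp_all add: \<sigma>_def X_def Y_def)
    have "linear \<sigma>" by (intro linearI) (simp_all add: \<sigma>_def vec_eq_iff)
    then have g: "(\<lambda>w. f (\<sigma> w)) \<in> functionals ?S"
      by (intro functionals_compose[OF assms(2)]) (auto simp: mem s inj_on_def eqI)
    have Yv: "Y v > 0" using vS X0 PQ by (simp add: fXY zero_less_mult_iff)
    have "v \<notin> core ?S f"
    proof (rule not_in_core[OF um assms(2) g _ vS(1)])
      show "f (\<sigma> v) < 0" using X0 Yv PQ by (simp add: fXY s)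
      fix w assume w: "w \<in> ?S" "f w > 0" "f (\<sigma> w) < 0"
      then have "X w = 0 \<and> Y w > 0" using cases[OF w(1)] PQ by (auto simp: fXY s)
      then have "Y w / Y v > 0 \<and> w = (Y w / Y v) *\<^sub>R v"
        using X0 Yv unfolding eqI scaled by simp
      then show "\<exists>c>0. w = c *\<^sub>R v" by blast
    qed
    with assms(3) show False by simp
  qed
  moreover have "(X v, Y v) \<noteq> (1, - 1)"
  proof
    assume v1: "(X v, Y v) = (1, - 1)"
    define \<sigma> where "\<sigma> w = (\<chi> k. s * t * (if k = i then w $ j else w $ i))" for w :: "real^2"
    have s: "X (\<sigma> w) = Y w" "Y (\<sigma> w) = X w" for w
      using ij sq st by (auto simp: \<sigma>_def X_def Y_def)
    have "linear \<sigma>" by (intro linearI) (simp_all add: \<sigma>_def vec_eq_iff algebra_simps)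
    then have g: "(\<lambda>w. f (\<sigma> w)) \<in> functionals ?S"
      by (intro functionals_compose[OF assms(2)]) (auto simp: mem s inj_on_def eqI add.commute)
    have "v \<notin> core ?S f"
    proof (rule not_in_core[OF um assms(2) g _ vS(1)])
      show "f (\<sigma> v) < 0" using v1 PQ by (simp add: fXY s)
      fix w assume w: "w \<in> ?S" "f w > 0" "f (\<sigma> w) < 0"
      then have "(X w, Y w) = (1, - 1)" using cases[OF w(1)] PQ by (auto simp: fXY s)
      then have "w = 1 *\<^sub>R v" using v1 by (simp add: eqI)
      then show "\<exists>c>0. w = c *\<^sub>R v" using zero_less_one by blast
    qed
    with assms(3) show False by simp
  qed
  ultimately show ?thesis
    using cases[OF vS(1)] vS(2) PQ unfolding fXY by (auto simp: X_def[symmetric] Y_def[symmetric])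
qed

text \<open>
  A functional that does not vanish on roots lies in an open Weyl chamber, and signed permutations
  of the coordinates move this chamber to the dominant one. The walls between the
  chambers are the lines orthogonal to the vectors of norm \<open>2\<close> and \<open>4\<close>.
\<close>

lemma integral_shell_dominant:
  assumes "{2, 4} \<subseteq> M" "f \<in> functionals (integral_shell M)"
  obtains i j :: 2 and s t P Q :: real where "i \<noteq> j" "s \<in> {1, - 1}" "t \<in> {1, - 1}"
    "\<And>w. f w = P * (s * w $ i) + Q * (t * w $ j)" "Q > 0" "P > Q"
proof -
  have lin: "linear f" and nz: "\<And>v. v \<in> integral_shell M \<Longrightarrow> f v \<noteq> 0"
    using assms(2) by (auto simp: functionals_def)
  define a where "a k = f (axis k 1)" for k :: 2
  have f: "f w = a 1 * w $ 1 + a 2 * w $ 2" for w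
  proof -
    have "w = w $ 1 *\<^sub>R axis 1 1 + w $ 2 *\<^sub>R axis 2 1" by (simp add: vec_eq_iff forall_2 axis_def)
    then have "f w = f (w $ 1 *\<^sub>R axis 1 1 + w $ 2 *\<^sub>R axis 2 1)" by simp
    then show ?thesis by (simp add: linear_add[OF lin] linear_scale[OF lin] a_def mult.commute)
  qed
  have mem: "vector [p, q] \<in> integral_shell M" if "p \<in> \<int>" "q \<in> \<int>" "p\<^sup>2 + q\<^sup>2 \<in> {2, 4}" for p q
    using that assms(1) by (auto simp: integral_shell_iff[of 1 2] vector_2)
  have "a 1 \<noteq> 0" using nz[OF mem[of 2 0]] by (simp add: f vector_2)
  moreover have "a 2 \<noteq> 0" using nz[OF mem[of 0 2]] by (simp add: f vector_2)
  moreover have "a 1 + a 2 \<noteq> 0" using nz[OF mem[of 1 1]] by (simp add: f vector_2)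
  moreover have "a 1 - a 2 \<noteq> 0" using nz[OF mem[of 1 "- 1"]] by (simp add: f vector_2)
  ultimately have ne: "a 1 \<noteq> 0" "a 2 \<noteq> 0" "\<bar>a 1\<bar> \<noteq> \<bar>a 2\<bar>" by linarith+
  note goal = that
  have *: thesis if ij: "i \<noteq> j" and less: "\<bar>a j\<bar> < \<bar>a i\<bar>" for i j
  proof (rule goal[OF ij])
    have nz: "a i \<noteq> 0" "a j \<noteq> 0" using ij ne by (cases rule: index2_cases; simp)+
    show "sgn (a i) \<in> {1, - 1}" "sgn (a j) \<in> {1, - 1}" using nz by (auto simp: sgn_if)
    show "f w = \<bar>a i\<bar> * (sgn (a i) * w $ i) + \<bar>a j\<bar> * (sgn (a j) * w $ j)" for w
      using ij by (cases rule: index2_cases) (simp_all add: f mult.assoc[symmetric] abs_mult_sgn)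
    show "0 < \<bar>a j\<bar>" "\<bar>a j\<bar> < \<bar>a i\<bar>" using nz less by simp_all
  qed
  show thesis using *[of 1 2] *[of 2 1] ne by (cases "\<bar>a 1\<bar> < \<bar>a 2\<bar>") auto
qed

section \<open>Crystallographic systems and their long roots\<close>

text \<open>
  A classical system together with a fixed invariant inner product.
\<close>

locale classical_roots =
  fixes \<Phi> :: "'a::real_vector set" and B :: "'a \<Rightarrow> 'a \<Rightarrow> real"
  assumes system: "root_system \<Phi>"
    and inner: "inner_product_on (span \<Phi>) B"
    and integral: "\<alpha> \<in> \<Phi> \<Longrightarrow> \<beta> \<in> \<Phi> \<Longrightarrow> 2 * B \<alpha> \<beta> / B \<beta> \<beta> \<in> \<int>"
    and reflected: "\<alpha> \<in> \<Phi> \<Longrightarrow> \<beta> \<in> \<Phi> \<Longrightarrow> \<alpha> - (2 * B \<alpha> \<beta> / B \<beta> \<beta>) *\<^sub>R \<beta> \<in> \<Phi>"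
begin

definition cartan :: "'a \<Rightarrow> 'a \<Rightarrow> real" where
  "cartan \<alpha> \<beta> = 2 * B \<alpha> \<beta> / B \<beta> \<beta>"

lemma fin: "finite \<Phi>" and nonzero: "\<alpha> \<in> \<Phi> \<Longrightarrow> \<alpha> \<noteq> 0" and zero_notin: "0 \<notin> \<Phi>"
  using system by (auto simp: root_system_def)

lemma uminus_root: "\<alpha> \<in> \<Phi> \<Longrightarrow> - \<alpha> \<in> \<Phi>"
  using system by (auto simp: root_system_def)

lemma bil: "bilinear B"
  using inner by (simp add: inner_product_on_def)

lemmas B_simps = bilinear_ladd[OF bil] bilinear_radd[OF bil] bilinear_lsub[OF bil] bilinear_rsub[OF bil]
  bilinear_lmul[OF bil] bilinear_rmul[OF bil] bilinear_lneg[OF bil] bilinear_rneg[OF bil]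
  bilinear_lzero[OF bil] bilinear_rzero[OF bil]

lemma B_sym: "\<alpha> \<in> \<Phi> \<Longrightarrow> \<beta> \<in> \<Phi> \<Longrightarrow> B \<alpha> \<beta> = B \<beta> \<alpha>"
  using inner by (simp add: inner_product_on_def span_base)

lemma B_pos_span: "x \<in> span \<Phi> \<Longrightarrow> x \<noteq> 0 \<Longrightarrow> B x x > 0"
  using inner by (simp add: inner_product_on_def)

lemma B_pos: "\<alpha> \<in> \<Phi> \<Longrightarrow> B \<alpha> \<alpha> > 0"
  using B_pos_span nonzero span_base by blast

lemma linear_cartan: "linear (\<lambda>x. cartan x \<beta>)"
  by (auto simp: cartan_def B_simps add_divide_distrib distrib_left intro!: linearI)

lemmas cartan_simps = linear_add[OF linear_cartan] linear_diff[OF linear_cartan]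
  linear_scale[OF linear_cartan] linear_neg[OF linear_cartan] linear_0[OF linear_cartan]

lemma cartan_self: "\<alpha> \<in> \<Phi> \<Longrightarrow> cartan \<alpha> \<alpha> = 2"
  using B_pos[of \<alpha>] by (simp add: cartan_def)

lemma cartan_Ints: "\<alpha> \<in> \<Phi> \<Longrightarrow> \<beta> \<in> \<Phi> \<Longrightarrow> cartan \<alpha> \<beta> \<in> \<int>"
  using integral by (simp add: cartan_def)

lemma reflect: "\<alpha> \<in> \<Phi> \<Longrightarrow> \<beta> \<in> \<Phi> \<Longrightarrow> \<alpha> - cartan \<alpha> \<beta> *\<^sub>R \<beta> \<in> \<Phi>"
  using reflected by (simp add: cartan_def)

lemma cartan_sgn:
  assumes "\<beta> \<in> \<Phi>"
  shows "cartan \<alpha> \<beta> > 0 \<longleftrightarrow> B \<alpha> \<beta> > 0" "cartan \<alpha> \<beta> = 0 \<longleftrightarrow> B \<alpha> \<beta> = 0"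
  using B_pos[OF assms] by (simp_all add: cartan_def zero_less_divide_iff)

lemma cartan_uminus_right: "cartan \<alpha> (- \<beta>) = - cartan \<alpha> \<beta>"
  by (simp add: cartan_def B_simps)

lemma B_reflect:
  assumes "\<beta> \<in> \<Phi>" "\<alpha> \<in> \<Phi>"
  shows "B (\<alpha> - cartan \<alpha> \<beta> *\<^sub>R \<beta>) (\<alpha> - cartan \<alpha> \<beta> *\<^sub>R \<beta>) = B \<alpha> \<alpha>"
proof -
  have "cartan \<alpha> \<beta> * B \<beta> \<beta> = 2 * B \<alpha> \<beta>" using B_pos[OF assms(1)] by (simp add: cartan_def)
  then show ?thesis
    using B_sym[OF assms] by (simp add: B_simps algebra_simps)
qed

text \<open>
  The hypothesis says that \<open>\<alpha> - \<beta>\<close> has non-positive square norm. This replaces the Cauchy-Schwarz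
  inequality with its equality case.
\<close>

lemma B_diff_nonpos_eq:
  assumes "\<alpha> \<in> \<Phi>" "\<beta> \<in> \<Phi>" "B \<alpha> \<alpha> + B \<beta> \<beta> \<le> 2 * B \<alpha> \<beta>"
  shows "\<alpha> = \<beta>"
proof (rule ccontr)
  assume "\<alpha> \<noteq> \<beta>"
  then have "B (\<alpha> - \<beta>) (\<alpha> - \<beta>) > 0"
    using assms by (intro B_pos_span) (auto intro: span_base span_diff)
  then show False using assms B_sym[of \<alpha> \<beta>] by (simp add: B_simps)
qed

lemma Ints_pos_cases:
  fixes x :: real
  assumes "x \<in> \<int>" "x > 0"
  shows "x = 1 \<or> x \<ge> 2"
  using assms by (auto elim!: Ints_cases)

text \<open>
  One of the two Cartan integers is \<open>1\<close>, unless both are at least \<open>2\<close> and then the roots coincide. If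
  it is \<open>1\<close>, then \<open>\<alpha> - \<beta>\<close> is a reflection of one of the roots, up to sign.
\<close>

lemma diff_root:
  assumes "\<alpha> \<in> \<Phi>" "\<beta> \<in> \<Phi>" "B \<alpha> \<beta> > 0" "\<alpha> \<noteq> \<beta>"
  shows "\<alpha> - \<beta> \<in> \<Phi>"
proof -
  have c: "cartan \<alpha> \<beta> > 0" "cartan \<beta> \<alpha> > 0"
    using assms cartan_sgn B_sym by simp_all
  consider "cartan \<alpha> \<beta> = 1" | "cartan \<beta> \<alpha> = 1" | "cartan \<alpha> \<beta> \<ge> 2" "cartan \<beta> \<alpha> \<ge> 2"
    using Ints_pos_cases[OF cartan_Ints[OF assms(1,2)] c(1)] Ints_pos_cases[OF cartan_Ints[OF assms(2,1)] c(2)]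
    by blast
  then show ?thesis
  proof cases
    case 1
    then show ?thesis using reflect[OF assms(1,2)] by simp
  next
    case 2
    then show ?thesis using reflect[OF assms(2,1)] uminus_root[of "\<beta> - \<alpha>"] by simp
  next
    case 3
    then have "B \<alpha> \<alpha> + B \<beta> \<beta> \<le> 2 * B \<alpha> \<beta>"
      using B_pos assms(1,2) B_sym[OF assms(1,2)] by (simp add: cartan_def field_simps)
    then show ?thesis using B_diff_nonpos_eq assms by blast
  qed
qed

definition long :: "'a \<Rightarrow> bool" where
  "long \<theta> \<longleftrightarrow> \<theta> \<in> \<Phi> \<and> (\<forall>\<alpha>\<in>\<Phi>. B \<alpha> \<alpha> \<le> B \<theta> \<theta>)"

lemma long_root: "long \<theta> \<Longrightarrow> \<theta> \<in> \<Phi>"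
  by (simp add: long_def)

lemma long_exists: "\<exists>\<theta>. long \<theta>"
proof -
  have "\<Phi> \<noteq> {}" using system by (simp add: root_system_def)
  then obtain \<theta> where "\<theta> \<in> \<Phi>" "B \<theta> \<theta> = Max ((\<lambda>\<alpha>. B \<alpha> \<alpha>) ` \<Phi>)"
    using Max_in[of "(\<lambda>\<alpha>. B \<alpha> \<alpha>) ` \<Phi>"] fin by fastforce
  then have "long \<theta>" using fin by (simp add: long_def)
  then show ?thesis by blast
qed

lemma long_uminus: "long \<theta> \<Longrightarrow> long (- \<theta>)"
  by (simp add: long_def uminus_root B_simps)

lemma long_reflect: "long \<theta> \<Longrightarrow> \<beta> \<in> \<Phi> \<Longrightarrow> long (\<theta> - cartan \<theta> \<beta> *\<^sub>R \<beta>)"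
  by (simp add: long_def B_reflect reflect)

text \<open>
  For long \<open>\<theta>\<close> the assumption gives \<open>(\<theta>,\<theta>) \<le> (\<alpha>,\<theta>)\<close>, which forces equality as \<open>\<alpha>\<close> is no longer
  than \<open>\<theta>\<close>.
\<close>

lemma cartan_long_ge2:
  assumes "long \<theta>" "\<alpha> \<in> \<Phi>" "cartan \<alpha> \<theta> \<ge> 2"
  shows "\<alpha> = \<theta>"
proof (rule B_diff_nonpos_eq)
  have "B \<theta> \<theta> \<le> B \<alpha> \<theta>"
    using assms(3) B_pos[OF long_root[OF assms(1)]] by (simp add: cartan_def field_simps)
  moreover have "B \<alpha> \<alpha> \<le> B \<theta> \<theta>" using assms(1,2) by (simp add: long_def)
  ultimately show "B \<alpha> \<alpha> + B \<theta> \<theta> \<le> 2 * B \<alpha> \<theta>" by simp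
qed (use assms long_root in auto)

lemma cartan_long_le_m2:
  assumes "long \<theta>" "\<alpha> \<in> \<Phi>" "cartan \<alpha> \<theta> \<le> - 2"
  shows "\<alpha> = - \<theta>"
  using cartan_long_ge2[OF assms(1) uminus_root[OF assms(2)]] assms(3)
  by (auto simp: cartan_simps)

lemma cartan_long_cases:
  assumes "long \<theta>" "\<alpha> \<in> \<Phi>" "\<alpha> \<noteq> \<theta>" "\<alpha> \<noteq> - \<theta>"
  shows "cartan \<alpha> \<theta> \<in> {-1, 0, 1}"
proof -
  have "cartan \<alpha> \<theta> < 2" "cartan \<alpha> \<theta> > - 2"
    using cartan_long_ge2[OF assms(1,2)] cartan_long_le_m2[OF assms(1,2)] assms(3,4) by fastforce+
  moreover obtain n where "cartan \<alpha> \<theta> = of_int n"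
    using cartan_Ints[OF assms(2) long_root[OF assms(1)]] by (auto elim: Ints_cases)
  ultimately have "n < 2" "n > -2" by simp_all
  then have "n = -1 \<or> n = 0 \<or> n = 1" by linarith
  then show ?thesis using \<open>cartan \<alpha> \<theta> = of_int n\<close> by auto
qed

end

section \<open>Irreducibility as connectedness\<close>

locale irreducible_roots = classical_roots +
  assumes irreducible: "irreducible_system \<Phi>"
begin

text \<open>
  If a set of roots were orthogonal to its complement, then by definiteness of the inner product the
  spans would meet only in zero.
\<close>

lemma connected:
  assumes "A \<subseteq> \<Phi>" "A \<noteq> {}" "A \<noteq> \<Phi>"
  obtains \<alpha> \<beta> where "\<alpha> \<in> A" "\<beta> \<in> \<Phi>" "\<beta> \<notin> A" "B \<alpha> \<beta> \<noteq> 0"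
proof (rule ccontr)
  assume no: "\<not> thesis"
  note found = that
  have orth: "B \<alpha> \<beta> = 0" if "\<alpha> \<in> A" "\<beta> \<in> \<Phi> - A" for \<alpha> \<beta>
    using no found that by blast
  have "x = 0" if x: "x \<in> span A" "x \<in> span (\<Phi> - A)" for x
  proof -
    have "B \<alpha> x = 0" if "\<alpha> \<in> A" for \<alpha>
      by (rule linear_eq_0_on_span[OF _ _ x(2), of "B \<alpha>"])
        (use bil orth that in \<open>auto simp: bilinear_def\<close>)
    then have "B x x = 0"
      by (intro linear_eq_0_on_span[OF _ _ x(1), of "\<lambda>y. B y x"])
        (use bil in \<open>auto simp: bilinear_def\<close>)
    moreover have "x \<in> span \<Phi>" using x(1) assms(1) span_mono by blast
    ultimately show "x = 0" using B_pos_span by force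
  qed
  then have "span A \<inter> span (\<Phi> - A) = {0}" by (auto intro: span_zero)
  then have "A \<noteq> {} \<and> \<Phi> - A \<noteq> {} \<and> A \<inter> (\<Phi> - A) = {} \<and> A \<union> (\<Phi> - A) = \<Phi> \<and>
      span A \<inter> span (\<Phi> - A) = {0}"
    using assms by auto
  then show False
    using irreducible unfolding irreducible_system_def by metis
qed

text \<open>
  If no such \<open>\<delta>\<close> existed, then \<open>\<gamma>\<close> would belong to the set \<open>K\<close> of roots orthogonal to all roots outside
  the kernel of \<open>\<eta>\<close>. By connectedness some \<open>\<kappa> \<in> K\<close> is not orthogonal to a root \<open>\<xi> \<notin> K\<close>, which must lie in the kernel. Take
  \<open>\<nu>\<close> outside the kernel and not orthogonal to \<open>\<xi>\<close>. The reflection of \<open>\<nu>\<close> in \<open>\<xi>\<close> has the same image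
  under \<open>\<eta>\<close> as \<open>\<nu>\<close>, so \<open>\<kappa>\<close> is orthogonal to both, hence to \<open>\<xi>\<close>.
\<close>

lemma kernel_root_linked:
  assumes "linear \<eta>" "\<gamma> \<in> \<Phi>" "\<eta> \<gamma> = 0" "\<exists>\<alpha>\<in>\<Phi>. \<eta> \<alpha> \<noteq> 0"
  obtains \<delta> where "\<delta> \<in> \<Phi>" "\<eta> \<delta> \<noteq> 0" "B \<gamma> \<delta> < 0"
proof -
  define N where "N = {\<alpha>\<in>\<Phi>. \<eta> \<alpha> \<noteq> 0}"
  define K where "K = {\<alpha>\<in>\<Phi>. \<forall>\<nu>\<in>N. B \<alpha> \<nu> = 0}"
  have "\<gamma> \<notin> K"
  proof
    assume "\<gamma> \<in> K"
    moreover have KN: "K \<inter> N = {}" using B_pos by (force simp: K_def N_def)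
    moreover have "K \<subseteq> \<Phi>" by (auto simp: K_def)
    moreover have "K \<noteq> \<Phi>" using KN assms(4) by (auto simp: N_def)
    ultimately obtain \<kappa> \<xi> where *: "\<kappa> \<in> K" "\<xi> \<in> \<Phi>" "\<xi> \<notin> K" "B \<kappa> \<xi> \<noteq> 0"
      using connected[of K] by blast
    then have "\<xi> \<notin> N" by (auto simp: K_def)
    then have z: "\<eta> \<xi> = 0" using *(2) by (auto simp: N_def)
    obtain \<nu> where nu: "\<nu> \<in> N" "B \<xi> \<nu> \<noteq> 0" using *(2,3) by (auto simp: K_def)
    have nuP: "\<nu> \<in> \<Phi>" using nu(1) by (simp add: N_def)
    define c where "c = cartan \<nu> \<xi>"
    have c: "c \<noteq> 0" using nu cartan_sgn(2)[OF *(2)] B_sym[OF nuP *(2)] by (simp add: c_def)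
    have "\<nu> - c *\<^sub>R \<xi> \<in> N"
      using reflect[OF nuP *(2)] nu(1) z
      by (simp add: N_def c_def linear_diff[OF assms(1)] linear_scale[OF assms(1)])
    then have "B \<kappa> (\<nu> - c *\<^sub>R \<xi>) = 0" "B \<kappa> \<nu> = 0" using *(1) nu(1) by (auto simp: K_def)
    then show False using c *(4) by (simp add: B_simps)
  qed
  then obtain \<delta> where d: "\<delta> \<in> \<Phi>" "\<eta> \<delta> \<noteq> 0" "B \<gamma> \<delta> \<noteq> 0" using assms(2) by (auto simp: K_def N_def)
  show thesis
  proof (cases "B \<gamma> \<delta> < 0")
    case True
    then show ?thesis using that d by blast
  next
    case False
    then show ?thesis
      using that[of "- \<delta>"] d uminus_root by (simp add: B_simps linear_neg[OF assms(1)])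
  qed
qed

text \<open>
  Connectedness for the set of roots in the span of \<open>W\<close>, which is a proper subset for reasons of
  rank.
\<close>

lemma root_outside_span:
  assumes "W \<subseteq> \<Phi>" "W \<noteq> {}" "card W < root_rank \<Phi>"
  obtains \<beta> \<omega> where "\<beta> \<in> \<Phi>" "\<beta> \<notin> span W" "\<omega> \<in> W" "B \<beta> \<omega> \<noteq> 0"
proof -
  have "finite W" using assms(1) fin finite_subset by blast
  have "\<Phi> \<inter> span W \<noteq> \<Phi>"
  proof
    assume "\<Phi> \<inter> span W = \<Phi>"
    then have "span \<Phi> \<subseteq> span W" by (intro span_minimal) auto
    then have "dim (span \<Phi>) \<le> card W" using \<open>finite W\<close> by (rule dim_le_card)
    with assms(3) show False by (simp add: root_rank_def)
  qed
  moreover have "\<Phi> \<inter> span W \<noteq> {}" using assms(1,2) span_base by blast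
  ultimately obtain \<alpha> \<beta> where *: "\<alpha> \<in> \<Phi> \<inter> span W" "\<beta> \<in> \<Phi>" "\<beta> \<notin> \<Phi> \<inter> span W" "B \<alpha> \<beta> \<noteq> 0"
    using connected[of "\<Phi> \<inter> span W"] by blast
  have "\<exists>\<omega>\<in>W. B \<beta> \<omega> \<noteq> 0"
  proof (rule ccontr)
    assume "\<not> ?thesis"
    then have "B \<beta> \<alpha> = 0"
      using linear_eq_0_on_span[of "B \<beta>" W \<alpha>] bil *(1) by (auto simp: bilinear_def)
    with * B_sym show False by simp
  qed
  with * that show thesis by blast
qed

end

section \<open>Existence of a linked pair of long roots\<close>

text \<open>
  The data that define the reduction. Without the connecting root \<open>\<delta>\<close> the projection could lose the
  vectors of norm two, and its image would be reducible.
\<close>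

definition (in classical_roots) linked :: "'a \<Rightarrow> 'a \<Rightarrow> bool" where
  "linked \<theta> \<phi> \<longleftrightarrow> long \<theta> \<and> long \<phi> \<and> B \<theta> \<phi> = 0 \<and> (\<exists>\<delta>\<in>\<Phi>. B \<delta> \<theta> \<noteq> 0 \<and> B \<delta> \<phi> \<noteq> 0)"

context classical_roots
begin

text \<open>
  With \<open>m\<close> the Cartan integer of \<open>\<theta>\<close> against \<open>\<beta>\<close>, the reflected root \<open>\<theta> - m \<beta>\<close> is long and has Cartan
  integer \<open>2 - m\<close> against \<open>\<theta>\<close>. As it is not \<open>\<plusminus>\<theta>\<close>, this number is \<open>-1\<close>, \<open>0\<close> or \<open>1\<close>, and for \<open>m = 2\<close> the
  reflected root is orthogonal to \<open>\<theta>\<close>.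
\<close>

lemma long_string:
  assumes "long \<theta>" "\<beta> \<in> \<Phi>" "\<beta> \<notin> span {\<theta>}" "cartan \<beta> \<theta> = 1"
  shows "linked \<theta> (\<theta> - 2 *\<^sub>R \<beta>) \<or> cartan \<theta> \<beta> = 1 \<or> cartan \<theta> \<beta> = 3"
proof -
  note th = long_root[OF assms(1)]
  define m where "m = cartan \<theta> \<beta>"
  have m0: "m > 0"
    using assms(4) cartan_sgn(1)[OF th, of \<beta>] cartan_sgn(1)[OF assms(2), of \<theta>] B_sym[OF th assms(2)]
    by (simp add: m_def)
  let ?r = "\<theta> - m *\<^sub>R \<beta>"
  have r: "long ?r" using long_reflect[OF assms(1,2)] by (simp add: m_def)
  have in_span: "\<beta> \<in> span {\<theta>}" if "m *\<^sub>R \<beta> = c *\<^sub>R \<theta>" for c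
  proof -
    have "\<beta> = (1 / m) *\<^sub>R (m *\<^sub>R \<beta>)" using m0 by simp
    also have "\<dots> = (c / m) *\<^sub>R \<theta>" unfolding that by simp
    finally show ?thesis by (auto simp: span_singleton)
  qed
  have "?r \<noteq> \<theta>" using in_span[of 0] assms(3) by auto
  moreover have "?r \<noteq> - \<theta>"
  proof
    assume "?r = - \<theta>"
    then have "m *\<^sub>R \<beta> = 2 *\<^sub>R \<theta>" by (simp add: algebra_simps scaleR_2)
    with in_span assms(3) show False by blast
  qed
  ultimately have "cartan ?r \<theta> \<in> {-1, 0, 1}"
    using cartan_long_cases[OF assms(1) long_root[OF r]] by blast
  then have "m = 3 \<or> m = 2 \<or> m = 1"
    using assms(4) cartan_self[OF th] by (auto simp: cartan_simps)
  moreover have "linked \<theta> (\<theta> - 2 *\<^sub>R \<beta>)" if "m = 2"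
  proof -
    have e: "B \<theta> \<beta> = B \<beta> \<beta>" "2 * B \<beta> \<theta> = B \<theta> \<theta>"
      using that assms(4) B_pos[OF assms(2)] B_pos[OF th] by (simp_all add: m_def cartan_def field_simps)
    then have "B \<theta> (\<theta> - 2 *\<^sub>R \<beta>) = 0" "B \<beta> \<theta> \<noteq> 0" "B \<beta> (\<theta> - 2 *\<^sub>R \<beta>) \<noteq> 0"
      using B_pos[OF assms(2)] B_sym[OF assms(2) th] by (simp_all add: B_simps)
    then show ?thesis
      using r that assms(1,2) by (auto simp: linked_def)
  qed
  ultimately show ?thesis by (auto simp: m_def)
qed

text \<open>
  The roots \<open>\<tau>\<close> and \<open>\<psi>\<close> are simple roots of an \<open>A\<^sub>2\<close> of long roots. If \<open>m = 1\<close>, with \<open>m\<close> the Cartan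
  integer of \<open>\<tau>\<close> against \<open>\<beta>\<close>, then \<open>\<beta>\<close> is itself long and orthogonal to \<open>\<psi>\<close>, and \<open>\<tau>\<close> connects the
  two. The case \<open>m = 3\<close> would force \<open>\<tau> - 3\<beta> = -(\<tau> + \<psi>)\<close> and put \<open>\<beta>\<close> into the plane of the \<open>A\<^sub>2\<close>.
\<close>

lemma linked_from_A2:
  assumes "long \<tau>" "long \<psi>" "cartan \<tau> \<psi> = - 1" "\<beta> \<in> \<Phi>" "\<beta> \<notin> span {\<tau>, \<psi>}"
    and "cartan \<beta> \<tau> = 1" "cartan \<beta> \<psi> = 0"
  shows "\<exists>\<theta> \<phi>. linked \<theta> \<phi>"
proof -
  note r = long_root[OF assms(1)] long_root[OF assms(2)]
  have eq: "B \<tau> \<tau> = B \<psi> \<psi>" using assms(1,2) r by (auto simp: long_def intro: antisym)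
  have pos: "B \<psi> \<psi> > 0" using B_pos r by blast
  have b: "B \<beta> \<psi> = 0" "2 * B \<beta> \<tau> = B \<psi> \<psi>" "2 * B \<tau> \<psi> = - B \<psi> \<psi>"
    using assms(3,6,7) eq pos by (simp_all add: cartan_def field_simps)
  have sum: "long (\<tau> + \<psi>)" using long_reflect[OF assms(1) r(2)] assms(3) by simp
  have "\<beta> \<notin> span {\<tau>}" using assms(5) span_mono[of "{\<tau>}" "{\<tau>, \<psi>}"] by blast
  from long_string[OF assms(1,4) this assms(6)]
  consider "\<exists>\<theta> \<phi>. linked \<theta> \<phi>" | "cartan \<tau> \<beta> = 1" | "cartan \<tau> \<beta> = 3" by blast
  then show ?thesis
  proof cases
    case 2
    then have "B \<beta> \<beta> = B \<psi> \<psi>"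
      using b B_sym[OF assms(4) r(1)] B_pos[OF assms(4)] by (simp add: cartan_def)
    then have "long \<beta>" using assms(2,4) by (simp add: long_def)
    moreover have "B \<tau> \<beta> \<noteq> 0" "B \<tau> \<psi> \<noteq> 0" using b pos B_sym[OF assms(4) r(1)] by auto
    ultimately have "linked \<beta> \<psi>" using assms(2) b r by (auto simp: linked_def)
    then show ?thesis by blast
  next
    case 3
    let ?r = "\<tau> - 3 *\<^sub>R \<beta>"
    have root: "?r \<in> \<Phi>" using reflect[OF r(1) assms(4)] 3 by simp
    have "B ?r (\<tau> + \<psi>) = - B \<psi> \<psi>" "B (\<tau> + \<psi>) (\<tau> + \<psi>) = B \<psi> \<psi>"
      using b eq B_sym[OF r] by (simp_all add: B_simps)
    then have "cartan ?r (\<tau> + \<psi>) = - 2" using pos by (simp add: cartan_def)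
    then have "?r = - (\<tau> + \<psi>)" using cartan_long_le_m2[OF sum root] by simp
    then have "3 *\<^sub>R \<beta> = 2 *\<^sub>R \<tau> + \<psi>" by (simp add: algebra_simps scaleR_2)
    then have "(1/3) *\<^sub>R (3 *\<^sub>R \<beta>) = (1/3) *\<^sub>R (2 *\<^sub>R \<tau> + \<psi>)" by (rule arg_cong)
    then have "\<beta> = (1/3) *\<^sub>R (2 *\<^sub>R \<tau> + \<psi>)" by simp
    moreover have "(1/3) *\<^sub>R (2 *\<^sub>R \<tau> + \<psi>) \<in> span {\<tau>, \<psi>}"
      by (intro span_scale span_add) (auto intro: span_base)
    ultimately show ?thesis using assms(5) by simp
  qed
qed

end

context irreducible_roots
begin

text \<open>
  A neighbour of a long root gives a linked pair or an \<open>A\<^sub>2\<close> of long roots \<open>\<theta>, \<phi>, \<theta> + \<phi>\<close>. A root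
  outside the plane of the \<open>A\<^sub>2\<close>, and not orthogonal to it, has three Cartan integers in \<open>{-1, 0, 1}\<close>,
  the third being the sum of the other two. So exactly one of the three long roots is orthogonal to
  it, and this one plays the role of \<open>\<psi>\<close> above.
\<close>

lemma linked_exists:
  assumes "root_rank \<Phi> > 2"
  shows "\<exists>\<theta> \<phi>. linked \<theta> \<phi>"
proof -
  obtain \<theta> where th: "long \<theta>" using long_exists by blast
  note thr = long_root[OF th]
  obtain \<beta> where be: "\<beta> \<in> \<Phi>" "\<beta> \<notin> span {\<theta>}" "B \<beta> \<theta> \<noteq> 0"
    using root_outside_span[of "{\<theta>}"] thr assms by auto
  have "\<beta> \<noteq> \<theta>" "\<beta> \<noteq> - \<theta>" using be(2) span_base[of \<theta> "{\<theta>}"] span_neg[of \<theta> "{\<theta>}"] by auto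
  then have "cartan \<beta> \<theta> = 1 \<or> cartan \<beta> \<theta> = - 1"
    using cartan_long_cases[OF th be(1)] be(3) cartan_sgn(2)[OF thr] by auto
  then obtain \<alpha> where al: "\<alpha> \<in> \<Phi>" "\<alpha> \<notin> span {\<theta>}" "cartan \<alpha> \<theta> = 1"
    using be(1,2) uminus_root[OF be(1)] cartan_simps(4)[of \<beta> \<theta>] span_neg[of "- \<beta>" "{\<theta>}"]
    by (metis minus_minus)
  have A2: "\<exists>\<theta> \<phi>. linked \<theta> \<phi>" if ph: "long \<phi>" "cartan \<phi> \<theta> = - 1" for \<phi>
  proof -
    note phr = long_root[OF ph(1)]
    have N: "B \<theta> \<theta> = B \<phi> \<phi>" using th ph thr phr by (auto simp: long_def intro: antisym)
    have th_ph: "cartan \<theta> \<phi> = - 1" using ph(2) B_sym[OF thr phr] N by (simp add: cartan_def)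
    \<comment> \<open>The third positive root of the \<open>A\<^sub>2\<close> spanned by \<open>\<theta>\<close> and \<open>\<phi>\<close>.\<close>
    let ?\<chi> = "\<theta> + \<phi>"
    have chi: "long ?\<chi>" using long_reflect[OF ph(1) thr] ph(2) by (simp add: add.commute)
    have chi_N: "B ?\<chi> ?\<chi> = B \<phi> \<phi>"
      using ph(2) B_sym[OF thr phr] N B_pos[OF thr] by (simp add: cartan_def B_simps field_simps)
    have chi_cartan: "cartan x ?\<chi> = cartan x \<theta> + cartan x \<phi>" for x
      unfolding cartan_def chi_N using N by (simp add: B_simps add_divide_distrib)
    have "card {\<theta>, \<phi>} \<le> 2" by (simp add: card_insert_if)
    then obtain \<gamma> where ga: "\<gamma> \<in> \<Phi>" "\<gamma> \<notin> span {\<theta>, \<phi>}" "B \<gamma> \<theta> \<noteq> 0 \<or> B \<gamma> \<phi> \<noteq> 0"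
      using root_outside_span[of "{\<theta>, \<phi>}"] thr phr assms by auto
    have in_plane: "x \<in> span {\<theta>, \<phi>}" if "x \<in> {\<theta>, \<phi>, ?\<chi>}" for x
      using that by (auto intro: span_base span_add)
    have cases: "cartan \<gamma> x \<in> {-1, 0, 1}" if "long x" "x \<in> {\<theta>, \<phi>, ?\<chi>}" for x
      using cartan_long_cases[OF that(1) ga(1)] in_plane[OF that(2)] ga(2) span_neg by metis
    have "cartan \<gamma> \<theta> \<noteq> 0 \<or> cartan \<gamma> \<phi> \<noteq> 0" using ga(3) cartan_sgn(2) thr phr by blast
    then obtain \<beta> where be: "\<beta> \<in> \<Phi>" "\<beta> \<notin> span {\<theta>, \<phi>}"
      and "(cartan \<beta> \<theta>, cartan \<beta> \<phi>) \<in> {(1, 0), (0, 1), (1, - 1)}"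
    proof -
      have "cartan \<gamma> \<theta> \<in> {-1, 0, 1}" "cartan \<gamma> \<phi> \<in> {-1, 0, 1}"
        "cartan \<gamma> \<theta> + cartan \<gamma> \<phi> \<in> {-1, 0, 1}"
        using cases[OF th] cases[OF ph(1)] cases[OF chi] unfolding chi_cartan by simp_all
      then have "(cartan \<gamma> \<theta>, cartan \<gamma> \<phi>) \<in> {(1, 0), (0, 1), (1, - 1)} \<or>
            (cartan (- \<gamma>) \<theta>, cartan (- \<gamma>) \<phi>) \<in> {(1, 0), (0, 1), (1, - 1)}"
        using \<open>cartan \<gamma> \<theta> \<noteq> 0 \<or> cartan \<gamma> \<phi> \<noteq> 0\<close> unfolding cartan_simps
        by (elim insertE emptyE) simp_all
      moreover have "- \<gamma> \<notin> span {\<theta>, \<phi>}" using ga(2) span_neg[of "- \<gamma>"] by auto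
      ultimately show ?thesis
        using that[of \<gamma>] that[of "- \<gamma>"] ga(1,2) uminus_root[OF ga(1)] by blast
    qed
    then consider "cartan \<beta> \<theta> = 1" "cartan \<beta> \<phi> = 0" | "cartan \<beta> \<theta> = 0" "cartan \<beta> \<phi> = 1"
      | "cartan \<beta> \<theta> = 1" "cartan \<beta> \<phi> = - 1" by auto
    then show ?thesis
    proof cases
      case 1
      then show ?thesis using linked_from_A2[OF th ph(1) th_ph be] by blast
    next
      case 2
      then show ?thesis
        using linked_from_A2[OF ph(1) th ph(2) be(1)] be(2) by (simp add: insert_commute)
    next
      case 3
      have "long (- ?\<chi>)" using chi by (rule long_uminus)
      moreover have neg: "cartan x (- ?\<chi>) = - cartan x \<theta> - cartan x \<phi>" for x
        unfolding cartan_uminus_right chi_cartan by simp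
      moreover have "cartan \<theta> (- ?\<chi>) = - 1" "cartan \<beta> (- ?\<chi>) = 0"
        using 3 th_ph cartan_self[OF thr] unfolding neg by simp_all
      moreover have "span {\<theta>, - ?\<chi>} \<subseteq> span {\<theta>, \<phi>}"
        using in_plane[of \<theta>] span_neg[OF in_plane[of ?\<chi>]] by (intro span_minimal) auto
      ultimately show ?thesis using linked_from_A2[OF th, of "- ?\<chi>" \<beta>] be 3 by blast
    qed
  qed
  from long_string[OF th al] consider "\<exists>\<theta> \<phi>. linked \<theta> \<phi>" | "cartan \<theta> \<alpha> = 1" | "cartan \<theta> \<alpha> = 3" by blast
  then show ?thesis
  proof cases
    case 1 then show ?thesis .
  next
    case 2
    \<comment> \<open>The second simple root of the \<open>A\<^sub>2\<close> is \<open>\<alpha> - \<theta>\<close> here, and \<open>\<theta> - 3\<alpha>\<close> in the last case.\<close>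
    have "long (- (\<theta> - \<alpha>))" "cartan (- (\<theta> - \<alpha>)) \<theta> = - 1"
      using long_uminus long_reflect[OF th al(1)] 2 al cartan_self[OF thr] by (simp_all add: cartan_simps del: minus_diff_eq)
    then show ?thesis using A2 by blast
  next
    case 3
    then show ?thesis
      using A2[of "\<theta> - 3 *\<^sub>R \<alpha>"] long_reflect[OF th al(1)] al cartan_self[OF thr]
      by (simp add: cartan_simps)
  qed
qed

end

section \<open>Decomposing roots along a linked pair\<close>

context classical_roots
begin

lemma linked_commute: "linked \<theta> \<phi> \<Longrightarrow> linked \<phi> \<theta>"
  using B_sym long_root by (auto simp: linked_def)

lemma cartan_scale_sign: "s \<in> {1, - 1} \<Longrightarrow> cartan \<alpha> (s *\<^sub>R \<beta>) = s * cartan \<alpha> \<beta>"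
  by (auto simp: cartan_uminus_right)

lemma linked_uminus_left: "linked \<theta> \<phi> \<Longrightarrow> linked (- \<theta>) \<phi>"
  by (simp add: linked_def B_simps long_uminus)

lemma linked_uminus: "linked \<theta> \<phi> \<Longrightarrow> linked \<theta> (- \<phi>)"
  using linked_uminus_left linked_commute by blast

lemma linked_scale_sign: "linked \<theta> \<phi> \<Longrightarrow> s \<in> {1, - 1} \<Longrightarrow> linked (s *\<^sub>R \<theta>) \<phi>"
  using linked_uminus_left[of \<theta> \<phi>] by (elim insertE emptyE) simp_all

lemma linked_cartan:
  assumes "linked \<theta> \<phi>"
  shows "cartan \<theta> \<theta> = 2" "cartan \<phi> \<phi> = 2" "cartan \<theta> \<phi> = 0" "cartan \<phi> \<theta> = 0" "\<theta> \<in> \<Phi>" "\<phi> \<in> \<Phi>"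
  using assms cartan_self cartan_sgn(2) long_root linked_commute[OF assms] by (auto simp: linked_def)

text \<open>
  The connecting root has both coordinates \<open>\<plusminus>1\<close>; reflections in \<open>\<theta>\<close> and \<open>\<phi>\<close> correct the signs
  independently.
\<close>

lemma linked_corner:
  assumes "linked \<theta> \<phi>"
  obtains \<delta> where "\<delta> \<in> \<Phi>" "cartan \<delta> \<theta> = 1" "cartan \<delta> \<phi> = 1"
proof -
  note r = linked_cartan[OF assms]
  have lo: "long \<theta>" "long \<phi>" using assms by (auto simp: linked_def)
  obtain \<delta> where d: "\<delta> \<in> \<Phi>" "cartan \<delta> \<theta> \<noteq> 0" "cartan \<delta> \<phi> \<noteq> 0"
    using assms cartan_sgn(2) r by (auto simp: linked_def)
  have "\<delta> \<noteq> \<theta>" "\<delta> \<noteq> - \<theta>" "\<delta> \<noteq> \<phi>" "\<delta> \<noteq> - \<phi>"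
    using d r by (auto simp: cartan_simps)
  then have pm: "cartan \<delta> \<theta> = 1 \<or> cartan \<delta> \<theta> = - 1" "cartan \<delta> \<phi> = 1 \<or> cartan \<delta> \<phi> = - 1"
    using cartan_long_cases[OF lo(1) d(1)] cartan_long_cases[OF lo(2) d(1)] d by auto
  define \<delta>' where "\<delta>' = (if cartan \<delta> \<theta> = 1 then \<delta> else \<delta> + \<theta>)"
  have d': "\<delta>' \<in> \<Phi>" "cartan \<delta>' \<theta> = 1" "cartan \<delta>' \<phi> = cartan \<delta> \<phi>"
    using pm(1) d(1) reflect[OF d(1) r(5)] r by (auto simp: \<delta>'_def cartan_simps)
  show thesis
  proof (cases "cartan \<delta> \<phi> = 1")
    case True
    then show ?thesis using that d' by simp
  next
    case False
    then show ?thesis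
      using that[of "\<delta>' + \<phi>"] pm(2) d' reflect[OF d'(1) r(6)] r by (auto simp: cartan_simps)
  qed
qed

text \<open>
  The roots above \<open>(2,0)\<close>, \<open>(1,0)\<close> and \<open>(1,1)\<close> are the ones that can lie above the core. Only
  \<open>(1,0)\<close> is not a matter of a single reflection: for \<open>\<delta>\<close> above \<open>(1,-1)\<close> the vector
  \<open>\<delta>' = \<theta> - \<phi> - \<delta>\<close> is another such root, and \<open>(\<gamma>,\<delta>) + (\<gamma>,\<delta>') = (\<gamma>,\<theta>) > 0\<close>.
\<close>

lemma linked_decomposition:
  assumes "linked \<theta> \<phi>" "\<gamma> \<in> \<Phi>" "(cartan \<gamma> \<theta>, cartan \<gamma> \<phi>) \<in> {(2, 0), (1, 0), (1, 1)}"
  obtains \<delta> where "\<delta> \<in> \<Phi>" "\<gamma> - \<delta> \<in> \<Phi>" "cartan \<delta> \<theta> = 1" "cartan \<delta> \<phi> = - 1"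
proof -
  note r = linked_cartan[OF assms(1)]
  obtain \<delta> where d: "\<delta> \<in> \<Phi>" "cartan \<delta> \<theta> = 1" "cartan \<delta> \<phi> = - 1"
    using linked_corner[OF linked_uminus[OF assms(1)]] by (auto simp: cartan_uminus_right)
  have dth: "\<delta> - \<theta> \<in> \<Phi>" using reflect[OF d(1) r(5)] d(2) by simp
  consider "cartan \<gamma> \<theta> = 2" | "cartan \<gamma> \<theta> = 1" "cartan \<gamma> \<phi> = 0" | "cartan \<gamma> \<theta> = 1" "cartan \<gamma> \<phi> = 1"
    using assms(3) by auto
  then show thesis
  proof cases
    case 1
    have "long \<theta>" using assms(1) by (simp add: linked_def)
    then have "\<gamma> = \<theta>" using cartan_long_ge2[of \<theta> \<gamma>] 1 assms(2) by simp
    moreover have "\<theta> - \<delta> \<in> \<Phi>" using uminus_root[OF dth] by simp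
    ultimately show ?thesis using that d by blast
  next
    case 2
    define \<delta>' where "\<delta>' = \<theta> - \<phi> - \<delta>"
    have "\<delta> - \<theta> + \<phi> \<in> \<Phi>" using reflect[OF dth r(6)] d r by (simp add: cartan_simps)
    then have d': "\<delta>' \<in> \<Phi>"
      using uminus_root[of "\<delta> - \<theta> + \<phi>"] by (simp add: \<delta>'_def algebra_simps)
    have c': "cartan \<delta>' \<theta> = 1" "cartan \<delta>' \<phi> = - 1" using d r by (simp_all add: \<delta>'_def cartan_simps)
    have "B \<gamma> \<delta> + B \<gamma> \<delta>' = B \<gamma> \<theta> - B \<gamma> \<phi>" by (simp add: \<delta>'_def B_simps)
    also have "\<dots> > 0" using 2 cartan_sgn r(5,6) by force
    finally have "B \<gamma> \<delta> > 0 \<or> B \<gamma> \<delta>' > 0" by linarith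
    moreover have "\<gamma> \<noteq> \<delta>" "\<gamma> \<noteq> \<delta>'" using 2 d c' by auto
    ultimately show ?thesis using that diff_root[OF assms(2)] d d' c' by blast
  next
    case 3
    have "\<gamma> - \<phi> \<in> \<Phi>" using reflect[OF assms(2) r(6)] 3 by simp
    then show ?thesis using that[of "\<gamma> - \<phi>"] 3 r by (simp add: cartan_simps)
  qed
qed

text \<open>
  The image contains all four unit vectors as soon as it contains one: signs change with \<open>\<gamma>\<close>, and
  subtracting a root above \<open>(-1,1)\<close> exchanges the two axes.
\<close>

lemma linked_unit:
  assumes "linked \<theta> \<phi>" "\<gamma> \<in> \<Phi>" "(cartan \<gamma> \<theta>)\<^sup>2 + (cartan \<gamma> \<phi>)\<^sup>2 = 1"
  obtains \<gamma>' where "\<gamma>' \<in> \<Phi>" "cartan \<gamma>' \<theta> = 1" "cartan \<gamma>' \<phi> = 0"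
proof -
  have "(cartan \<gamma> \<theta>, cartan \<gamma> \<phi>) \<in> {(1, 0), (-1, 0), (0, 1), (0, -1)}"
    using integral_norm_cases[of "cartan \<gamma> \<theta>" "cartan \<gamma> \<phi>"] assms(3)
      cartan_Ints[OF assms(2)] linked_cartan(5,6)[OF assms(1)] by simp
  then have "\<exists>\<gamma>\<in>\<Phi>. (cartan \<gamma> \<theta>, cartan \<gamma> \<phi>) \<in> {(1, 0), (0, 1)}"
    using assms(2) uminus_root[OF assms(2)]
    by (intro bexI[of _ "if cartan \<gamma> \<theta> + cartan \<gamma> \<phi> = 1 then \<gamma> else - \<gamma>"]) (auto simp: cartan_simps)
  then obtain \<gamma>\<^sub>0 where g: "\<gamma>\<^sub>0 \<in> \<Phi>" "(cartan \<gamma>\<^sub>0 \<theta>, cartan \<gamma>\<^sub>0 \<phi>) \<in> {(1, 0), (0, 1)}" ..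
  show thesis
  proof (cases "cartan \<gamma>\<^sub>0 \<theta> = 1")
    case True
    then show ?thesis using that g by auto
  next
    case False
    then have c: "cartan \<gamma>\<^sub>0 \<theta> = 0" "cartan \<gamma>\<^sub>0 \<phi> = 1" using g by auto
    then obtain \<delta> where "\<delta> \<in> \<Phi>" "\<gamma>\<^sub>0 - \<delta> \<in> \<Phi>" "cartan \<delta> \<phi> = 1" "cartan \<delta> \<theta> = - 1"
      using linked_decomposition[OF linked_commute[OF assms(1)] g(1)] by auto
    then show ?thesis using that[of "\<gamma>\<^sub>0 - \<delta>"] c by (simp add: cartan_simps)
  qed
qed

text \<open>
  Norm \<open>4\<close> occurs only for \<open>\<plusminus>\<theta>\<close> and \<open>\<plusminus>\<phi>\<close>; for all other roots the coordinates are \<open>-1\<close>, \<open>0\<close> or \<open>1\<close>.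
\<close>

lemma linked_norm:
  assumes "linked \<theta> \<phi>" "\<alpha> \<in> \<Phi>"
  shows "(cartan \<alpha> \<theta>)\<^sup>2 + (cartan \<alpha> \<phi>)\<^sup>2 \<in> {0, 1, 2, 4}"
proof -
  note r = linked_cartan[OF assms(1)]
  have lo: "long \<theta>" "long \<phi>" using assms by (auto simp: linked_def)
  show ?thesis
  proof (cases "\<alpha> \<in> {\<theta>, - \<theta>, \<phi>, - \<phi>}")
    case True
    then show ?thesis using r by (auto simp: cartan_simps)
  next
    case False
    then have "cartan \<alpha> \<theta> \<in> {-1, 0, 1}" "cartan \<alpha> \<phi> \<in> {-1, 0, 1}"
      using cartan_long_cases[OF lo(1) assms(2)] cartan_long_cases[OF lo(2) assms(2)] by simp_all
    then show ?thesis by auto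
  qed
qed

end

section \<open>The projection onto a linked pair\<close>

text \<open>
  The orthogonal projection onto the plane of a linked pair, in coordinates scaled so that the pair
  goes to \<open>(2,0)\<close> and \<open>(0,2)\<close>. Indexing the pair by the coordinates of the plane makes permutations
  of the pair available as permutations of the index.
\<close>

definition (in classical_roots) pair_map :: "(2 \<Rightarrow> 'a) \<Rightarrow> 'a \<Rightarrow> real^2" where
  "pair_map \<Theta> x = (\<chi> k. cartan x (\<Theta> k))"

context classical_roots
begin

lemma pair_map_nth: "pair_map \<Theta> x $ k = cartan x (\<Theta> k)"
  by (simp add: pair_map_def)

lemma linear_pair_map: "linear (pair_map \<Theta>)"
  by (intro linearI) (simp_all add: pair_map_def vec_eq_iff cartan_simps)

text \<open>
  Signs and order of a linked pair can be chosen freely. This is how a statement about one Weyl chamber of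
  the image transfers to all of them.
\<close>

lemma linked_frame:
  fixes i j :: 2
  assumes "linked (\<Theta> 1) (\<Theta> 2)" "i \<noteq> j" "s \<in> {1, - 1}" "t \<in> {1, - 1}"
  shows "linked (s *\<^sub>R \<Theta> i) (t *\<^sub>R \<Theta> j)"
proof -
  have "linked (\<Theta> i) (\<Theta> j)"
    using assms(2) by (cases rule: index2_cases) (use assms(1) linked_commute in auto)
  then show ?thesis
    using linked_scale_sign assms(3,4) linked_commute by blast
qed

lemma pair_map_integral_norm:
  assumes "linked (\<Theta> 1) (\<Theta> 2)" "\<alpha> \<in> \<Phi>"
  shows "pair_map \<Theta> \<alpha> \<in> integral_shell {0, 1, 2, 4}"
  using linked_norm[OF assms] cartan_Ints[OF assms(2)] linked_cartan(5,6)[OF assms(1)]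
  by (simp add: integral_shell_iff[of 1 2] pair_map_nth)

lemma signed_coordinate:
  assumes "s \<in> {1, - 1}" "cartan \<alpha> (s *\<^sub>R \<theta>) = c"
  shows "cartan \<alpha> \<theta> = s * c"
  using assms cartan_scale_sign[OF assms(1)] by auto

text \<open>
  The pair itself yields the vectors of norm \<open>4\<close>, connecting roots for all choices of signs those of
  norm \<open>2\<close>. If some root lies above a unit vector, then roots lie above all unit vectors; whether
  this happens decides between the two possible images.
\<close>

lemma pair_map_image:
  assumes "linked (\<Theta> 1) (\<Theta> 2)"
  obtains M where "{2, 4} \<subseteq> M" "M \<subseteq> {1, 2, 4}" "pair_map \<Theta> ` \<Phi> - {0} = integral_shell M"
proof -
  define M :: "real set" where 
    "M = (if \<exists>\<gamma>\<in>\<Phi>. pair_map \<Theta> \<gamma> \<in> integral_shell {1} then {1, 2, 4} else {2, 4})"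
  have M: "{2, 4} \<subseteq> M" "M \<subseteq> {1, 2, 4}" by (auto simp: M_def)
  have eqI: "v = w" if "v $ i = w $ i" "v $ j = w $ j" "i \<noteq> j" for v w :: "real^2" and i j
    using that(3) by (cases rule: index2_cases) (use that in \<open>auto simp: vec_eq_iff forall_2\<close>)
  have "pair_map \<Theta> \<alpha> \<in> integral_shell M" if a: "\<alpha> \<in> \<Phi>" "pair_map \<Theta> \<alpha> \<noteq> 0" for \<alpha>
  proof -
    have "pair_map \<Theta> \<alpha> \<bullet> pair_map \<Theta> \<alpha> \<noteq> 0" using a(2) by simp
    then have "pair_map \<Theta> \<alpha> \<in> integral_shell {1, 2, 4}"
      using pair_map_integral_norm[OF assms a(1)] by (simp add: integral_shell_def)
    then show ?thesis using a(1) by (auto simp: integral_shell_def M_def split: if_splits)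
  qed
  moreover have "v \<in> pair_map \<Theta> ` \<Phi>" if v: "v \<in> integral_shell M" for v
  proof -
    have Z: "v $ 1 \<in> \<int>" "v $ 2 \<in> \<int>" "(v $ 1)\<^sup>2 + (v $ 2)\<^sup>2 \<in> {1, 2, 4}" "(v $ 1)\<^sup>2 + (v $ 2)\<^sup>2 \<in> M"
      using v M(2) by (auto simp: integral_shell_iff[of 1 2])
    consider (diag) "v $ 1 \<in> {1, - 1}" "v $ 2 \<in> {1, - 1}"
      | (axis) i j s c where "i \<noteq> j" "s \<in> {1, - 1 :: real}" "v $ i = s * c" "v $ j = 0" "c = 2 \<or> c = 1 \<and> 1 \<in> M"
    proof -
      have ax: thesis if "i \<noteq> j" "v $ j = 0" "v $ i \<in> {2, - 2} \<or> v $ i \<in> {1, - 1} \<and> 1 \<in> M" for i j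
      proof -
        have "v $ i \<noteq> 0" using that(3) by auto
        then have "sgn (v $ i) \<in> {1, - 1}" by (auto simp: sgn_if)
        moreover have "v $ i = sgn (v $ i) * \<bar>v $ i\<bar>" by (simp add: sgn_mult_abs)
        moreover have "\<bar>v $ i\<bar> = 2 \<or> \<bar>v $ i\<bar> = 1 \<and> 1 \<in> M" using that(3) by auto
        ultimately show thesis using axis that(1,2) by blast
      qed
      from integral_norm_cases[OF Z(1-3)] show thesis
      proof (elim disjE conjE)
        assume "(v $ 1, v $ 2) \<in> {(1, 0), (- 1, 0), (0, 1), (0, - 1)}" "(v $ 1)\<^sup>2 + (v $ 2)\<^sup>2 = 1"
        then show thesis using ax[of 1 2] ax[of 2 1] Z(4) by auto
      next
        assume "(v $ 1, v $ 2) \<in> {(1, 1), (1, - 1), (- 1, 1), (- 1, - 1)}"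
        then show thesis using diag by auto
      next
        assume "(v $ 1, v $ 2) \<in> {(2, 0), (- 2, 0), (0, 2), (0, - 2)}"
        then show thesis using ax[of 1 2] ax[of 2 1] by auto
      qed
    qed
    then show ?thesis
    proof cases
      case diag
      obtain \<delta> where d: "\<delta> \<in> \<Phi>" "cartan \<delta> (v $ 1 *\<^sub>R \<Theta> 1) = 1" "cartan \<delta> (v $ 2 *\<^sub>R \<Theta> 2) = 1"
        by (rule linked_corner[OF linked_frame[of \<Theta> 1 2, OF assms _ diag]]) simp_all
      then have "v = pair_map \<Theta> \<delta>"
        using signed_coordinate[OF diag(1) d(2)] signed_coordinate[OF diag(2) d(3)]
        by (simp add: vec_eq_iff forall_2 pair_map_nth)
      with d(1) show ?thesis by blast
    next
      case (axis i j s c)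
      have one: "1 \<in> {1, - 1 :: real}" by simp
      note fr = linked_frame[OF assms axis(1,2) one, unfolded scaleR_one]
      have "\<exists>\<gamma>\<in>\<Phi>. cartan \<gamma> (s *\<^sub>R \<Theta> i) = c \<and> cartan \<gamma> (\<Theta> j) = 0"
      proof (cases "c = 2")
        case True
        then show ?thesis using linked_cartan[OF fr] by blast
      next
        case False
        then have c: "c = 1" "1 \<in> M" using axis(5) by auto
        then obtain \<gamma> where g: "\<gamma> \<in> \<Phi>" "pair_map \<Theta> \<gamma> \<in> integral_shell {1}" by (auto simp: M_def split: if_splits)
        have "(cartan \<gamma> (\<Theta> i))\<^sup>2 + (cartan \<gamma> (\<Theta> j))\<^sup>2 = 1"
          using g(2) by (simp add: integral_shell_iff[OF axis(1)] pair_map_nth)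
        moreover have "(cartan \<gamma> (s *\<^sub>R \<Theta> i))\<^sup>2 = (cartan \<gamma> (\<Theta> i))\<^sup>2"
          using axis(2) by (auto simp: cartan_uminus_right)
        ultimately show ?thesis using linked_unit[OF fr g(1)] c(1) by metis
      qed
      then obtain \<gamma> where g: "\<gamma> \<in> \<Phi>" "cartan \<gamma> (s *\<^sub>R \<Theta> i) = c" "cartan \<gamma> (\<Theta> j) = 0" by blast
      have "v = pair_map \<Theta> \<gamma>"
        by (rule eqI[OF _ _ axis(1)]) (use axis g(3) signed_coordinate[OF axis(2) g(2)] in \<open>simp_all add: pair_map_nth\<close>)
      with g(1) show ?thesis by blast
    qed
  qed
  moreover have "0 \<notin> integral_shell M" using M(2) by (auto simp: integral_shell_def)
  ultimately have "pair_map \<Theta> ` \<Phi> - {0} = integral_shell M" by blast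
  with M that show thesis by blast
qed

text \<open>
  The functionals \<open>p\<close> and \<open>q\<close> are the coordinates for which \<open>f\<close> is dominant. In these coordinates
  \<open>\<delta>\<close> lies above \<open>(1,-1)\<close> and \<open>\<gamma> - \<delta>\<close> above \<open>(1,1)\<close>, \<open>(0,1)\<close> or \<open>(0,2)\<close>, so both are positive and the
  determinant does not vanish.
\<close>

lemma core_lift_decomposes:
  assumes "linked (\<Theta> 1) (\<Theta> 2)" "{2, 4} \<subseteq> M" "M \<subseteq> {1, 2, 4}"
    and "f \<in> functionals (integral_shell M)" "pair_map \<Theta> \<gamma> \<in> core (integral_shell M) f" "\<gamma> \<in> \<Phi>"
  obtains \<delta> and p q :: "'a \<Rightarrow> real" where "\<delta> \<in> \<Phi>" "\<gamma> - \<delta> \<in> \<Phi>" "linear p" "linear q"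
    "f (pair_map \<Theta> \<delta>) > 0" "f (pair_map \<Theta> (\<gamma> - \<delta>)) > 0"
    "\<And>x. pair_map \<Theta> x = 0 \<longleftrightarrow> p x = 0 \<and> q x = 0"
    "p \<delta> * q (\<gamma> - \<delta>) \<noteq> p (\<gamma> - \<delta>) * q \<delta>"
proof -
  let ?\<eta> = "pair_map \<Theta>"
  obtain i j s t P Q where ij: "i \<noteq> (j::2)" and st: "s \<in> {1, - 1 :: real}" "t \<in> {1, - 1 :: real}"
    and f: "\<And>w. f w = P * (s * w $ i) + Q * (t * w $ j)" and PQ: "Q > 0" "P > Q"
    by (rule integral_shell_dominant[OF assms(2,4)]) (rule that)
  define p where "p x = cartan x (s *\<^sub>R \<Theta> i)" for x
  define q where "q x = cartan x (t *\<^sub>R \<Theta> j)" for x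
  have pq: "p x = s * ?\<eta> x $ i" "q x = t * ?\<eta> x $ j" for x
    using cartan_scale_sign st by (simp_all only: p_def q_def pair_map_nth)
  have lin: "linear p" "linear q" unfolding p_def q_def by (rule linear_cartan)+
  have f_pq: "f (?\<eta> x) = P * p x + Q * q x" for x by (simp add: f pq)
  have "(p \<gamma>, q \<gamma>) \<in> {(2, 0), (1, 0), (1, 1)}"
    using integral_shell_core[OF assms(3-5) ij st f PQ] by (simp add: pq)
  note \<gamma> = this
  obtain \<delta> where d: "\<delta> \<in> \<Phi>" "\<gamma> - \<delta> \<in> \<Phi>" "p \<delta> = 1" "q \<delta> = - 1"
    using linked_decomposition[OF linked_frame[OF assms(1) ij st] assms(6) \<gamma>[unfolded p_def q_def]]
    by (auto simp: p_def q_def)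
  have d': "p (\<gamma> - \<delta>) = p \<gamma> - 1" "q (\<gamma> - \<delta>) = q \<gamma> + 1"
    using d by (simp_all add: linear_diff[OF lin(1)] linear_diff[OF lin(2)])
  show thesis
  proof (rule that[OF d(1,2) lin])
    show "f (?\<eta> \<delta>) > 0" using d PQ by (simp add: f_pq)
    show "f (?\<eta> (\<gamma> - \<delta>)) > 0" unfolding f_pq d' using \<gamma> PQ by auto
    show "?\<eta> x = 0 \<longleftrightarrow> p x = 0 \<and> q x = 0" for x
    proof -
      have "?\<eta> x = 0 \<longleftrightarrow> ?\<eta> x $ i = 0 \<and> ?\<eta> x $ j = 0"
        using ij by (cases rule: index2_cases) (auto simp: vec_eq_iff forall_2)
      then show ?thesis using st by (auto simp: pq)
    qed
    show "p \<delta> * q (\<gamma> - \<delta>) \<noteq> p (\<gamma> - \<delta>) * q \<delta>" unfolding d' d(3,4) using \<gamma> by auto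
  qed
qed

end

context irreducible_roots
begin

text \<open>
  This is condition (a). After a choice of sign the root \<open>\<delta>\<close> outside the kernel has negative product
  with \<open>\<gamma>\<close>, so \<open>\<gamma> + \<delta>\<close> is a third root in the plane.
\<close>

lemma good_kernel:
  assumes "linear \<eta>" "\<exists>\<alpha>\<in>\<Phi>. \<eta> \<alpha> \<noteq> 0" "\<gamma> \<in> \<Phi>" "\<eta> \<gamma> = 0"
  shows "\<exists>\<Psi>. subsystem \<Psi> \<Phi> \<and> irreducible_system \<Psi> \<and> regular_system \<Psi> \<and> root_rank \<Psi> = 2 \<and>
    \<gamma> \<in> \<Psi> \<and> {\<alpha>\<in>\<Psi>. \<eta> \<alpha> = 0} \<subseteq> span {\<gamma>}"
proof -
  obtain \<delta> where d: "\<delta> \<in> \<Phi>" "\<eta> \<delta> \<noteq> 0" "B \<gamma> \<delta> < 0"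
    using kernel_root_linked[OF assms(1,3,4,2)] by blast
  have "\<gamma> \<noteq> - \<delta>" using d(2) assms(4) linear_neg[OF assms(1), of \<delta>] by auto
  then have "\<gamma> + \<delta> \<in> \<Phi>"
    using diff_root[OF assms(3) uminus_root[OF d(1)]] d(3) by (simp add: B_simps)
  have ker: "\<alpha> \<in> span {\<gamma>}" if \<alpha>: "\<alpha> \<in> span {\<gamma>, \<delta>}" "\<eta> \<alpha> = 0" for \<alpha>
  proof -
    obtain a b where ab: "\<alpha> = a *\<^sub>R \<gamma> + b *\<^sub>R \<delta>"
      using \<alpha>(1) by (rule span_pairE)
    then have "b = 0"
      using \<alpha>(2) assms(4) d(2) by (simp add: linear_add[OF assms(1)] linear_scale[OF assms(1)])
    then show ?thesis using ab by (auto simp: span_singleton)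
  qed
  have "\<delta> \<notin> span {\<gamma>}"
    using d(2) assms(4) by (auto simp: span_singleton linear_scale[OF assms(1)])
  then have "independent {\<delta>, \<gamma>}" "\<gamma> \<noteq> \<delta>"
    using independent_insertI[of \<delta> "{\<gamma>}"] nonzero[OF assms(3)] span_base[of \<gamma> "{\<gamma>}"] by auto
  then have ind: "independent {\<gamma>, \<delta>}" "\<gamma> \<noteq> \<delta>" by (simp_all only: insert_commute not_False_eq_True)
  define \<Psi> where "\<Psi> = \<Phi> \<inter> span {\<gamma>, \<delta>}"
  note \<Psi> = plane_subsystem[OF zero_notin assms(3) d(1) \<open>\<gamma> + \<delta> \<in> \<Phi>\<close> ind, folded \<Psi>_def]
  have "subsystem \<Psi> \<Psi>" using span_superset by (auto simp: subsystem_def)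
  then have "regular_system \<Psi>" using \<Psi> unfolding regular_system_def by blast
  moreover have "\<gamma> \<in> \<Psi>" using assms(3) by (auto simp: \<Psi>_def intro: span_base)
  moreover have "{\<alpha>\<in>\<Psi>. \<eta> \<alpha> = 0} \<subseteq> span {\<gamma>}" using ker by (auto simp: \<Psi>_def)
  ultimately show ?thesis using \<Psi> by blast
qed

end

context classical_roots
begin

text \<open>
  This is condition (b) for a root that splits as a sum of positive roots. Since \<open>\<eta>\<close> is injective on
  the plane of \<open>\<delta>\<close> and \<open>\<epsilon>\<close>, the pullback of \<open>f\<close> is a generic functional on the roots in that plane,
  and within that plane the preimage of the line through \<open>\<eta> (\<delta> + \<epsilon>)\<close> is the line through \<open>\<delta> + \<epsilon>\<close>.
\<close>

lemma good_core:
  fixes \<eta> :: "'a \<Rightarrow> 'b::real_vector"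
  assumes "linear \<eta>" "f \<in> functionals (\<eta> ` \<Phi> - {0})" "\<delta> \<in> \<Phi>" "\<epsilon> \<in> \<Phi>" "\<delta> + \<epsilon> \<in> \<Phi>"
    and "f (\<eta> \<delta>) > 0" "f (\<eta> \<epsilon>) > 0" "independent {\<delta>, \<epsilon>}" "\<delta> \<noteq> \<epsilon>"
    and inj: "\<And>x. x \<in> span {\<delta>, \<epsilon>} \<Longrightarrow> \<eta> x = 0 \<Longrightarrow> x = 0"
  shows "\<exists>\<Psi>. subsystem \<Psi> \<Phi> \<and> irreducible_system \<Psi> \<and> root_rank \<Psi> = 2 \<and>
    (\<exists>g\<in>functionals \<Psi>. \<delta> + \<epsilon> \<in> core \<Psi> g \<and>
      \<eta> ` positive_roots \<Psi> g \<subseteq> positive_roots (\<eta> ` \<Phi> - {0}) f \<and>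
      \<Psi> \<inter> \<eta> -` span {\<eta> (\<delta> + \<epsilon>)} \<subseteq> span {\<delta> + \<epsilon>})"
proof -
  define \<Psi> where "\<Psi> = \<Phi> \<inter> span {\<delta>, \<epsilon>}"
  let ?g = "\<lambda>x. f (\<eta> x)"
  note \<Psi> = plane_subsystem[OF zero_notin assms(3-5,8,9), folded \<Psi>_def]
  have lf: "linear f" using assms(2) by (simp add: functionals_def)
  have im: "\<eta> x \<in> \<eta> ` \<Phi> - {0}" if "x \<in> \<Psi>" for x
    using that inj nonzero by (auto simp: \<Psi>_def)
  have eq: "x = y" if "x \<in> span {\<delta>, \<epsilon>}" "y \<in> span {\<delta>, \<epsilon>}" "\<eta> x = \<eta> y" for x y
    using inj[of "x - y"] that by (simp add: span_diff linear_diff[OF assms(1)])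
  have g: "?g \<in> functionals \<Psi>"
  proof -
    have "linear ?g" using linear_compose[OF assms(1) lf] by (simp add: o_def)
    moreover have "?g x \<noteq> 0" if "x \<in> \<Psi>" for x
      using im[OF that] assms(2) by (auto simp: functionals_def)
    moreover have "?g x \<noteq> ?g y" if "x \<in> \<Psi>" "y \<in> \<Psi>" "x \<noteq> y" for x y
    proof -
      have "\<eta> x \<noteq> \<eta> y" using eq that by (auto simp: \<Psi>_def)
      with im[OF that(1)] im[OF that(2)] show ?thesis using assms(2) unfolding functionals_def by simp
    qed
    ultimately show ?thesis by (simp add: functionals_def)
  qed
  have mem: "\<delta> \<in> \<Psi>" "\<epsilon> \<in> \<Psi>" "\<delta> + \<epsilon> \<in> \<Psi>"
    using assms(3-5) by (auto simp: \<Psi>_def intro: span_base span_add)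
  have "\<delta> + \<epsilon> \<in> core \<Psi> ?g"
    by (rule core_sum[OF _ g mem _ assms(8,9,6,7)]) (use fin in \<open>auto simp: \<Psi>_def\<close>)
  moreover have "\<eta> ` positive_roots \<Psi> ?g \<subseteq> positive_roots (\<eta> ` \<Phi> - {0}) f"
    using im by (auto simp: positive_roots_def)
  moreover have "x \<in> span {\<delta> + \<epsilon>}" if x: "x \<in> \<Psi>" "\<eta> x \<in> span {\<eta> (\<delta> + \<epsilon>)}" for x
  proof -
    obtain c where "\<eta> x = c *\<^sub>R \<eta> (\<delta> + \<epsilon>)" using x(2) by (auto simp: span_singleton)
    then have "\<eta> x = \<eta> (c *\<^sub>R (\<delta> + \<epsilon>))" by (simp add: linear_scale[OF assms(1)])
    then have "x = c *\<^sub>R (\<delta> + \<epsilon>)"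
      using eq x(1) mem(3) span_scale by (metis IntD2 \<Psi>_def)
    then show ?thesis by (auto simp: span_singleton)
  qed
  ultimately show ?thesis using \<Psi> g by blast
qed

end

section \<open>Existence of a good reduction\<close>

theorem proposition6p4:
  fixes \<Phi> :: "'a::real_vector set"
  assumes "root_system \<Phi>" and "irreducible_system \<Phi>" and "classical_system \<Phi>"
    and "root_rank \<Phi> > 2"
  shows "\<exists>(\<Phi>' :: (real^2) set) (\<eta> :: 'a \<Rightarrow> real^2).
           root_system \<Phi>' \<and> irreducible_system \<Phi>' \<and> classical_system \<Phi>' \<and> root_rank \<Phi>' = 2 \<and>
           good_reduction 2 \<eta> \<Phi> \<Phi>'"
proof -
  obtain B where B: "inner_product_on (span \<Phi>) B"
    "\<And>\<alpha> \<beta>. \<alpha> \<in> \<Phi> \<Longrightarrow> \<beta> \<in> \<Phi> \<Longrightarrow> 2 * B \<alpha> \<beta> / B \<beta> \<beta> \<in> \<int>"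
    "\<And>\<alpha> \<beta>. \<alpha> \<in> \<Phi> \<Longrightarrow> \<beta> \<in> \<Phi> \<Longrightarrow> \<alpha> - (2 * B \<alpha> \<beta> / B \<beta> \<beta>) *\<^sub>R \<beta> \<in> \<Phi>"
    using assms(3) unfolding classical_system_def by blast
  interpret irreducible_roots \<Phi> B
    by unfold_locales (use assms B in auto)
  obtain \<theta> \<phi> where "linked \<theta> \<phi>" using linked_exists[OF assms(4)] by blast
  define \<Theta> :: "2 \<Rightarrow> 'a" where "\<Theta> k = (if k = 1 then \<theta> else \<phi>)" for k
  have \<Theta>: "linked (\<Theta> 1) (\<Theta> 2)" using \<open>linked \<theta> \<phi>\<close> by (simp add: \<Theta>_def)
  define \<eta> where "\<eta> = pair_map \<Theta>"
  have lin: "linear \<eta>" unfolding \<eta>_def by (rule linear_pair_map)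
  obtain M where M: "{2, 4} \<subseteq> M" "M \<subseteq> {1, 2, 4}" and im: "\<eta> ` \<Phi> - {0} = integral_shell M"
    using pair_map_image[OF \<Theta>] unfolding \<eta>_def by blast
  have "finite (integral_shell M)" using fin unfolding im[symmetric] by simp
  note image = integral_shell_root_system[OF M this]
  have nz: "\<exists>\<alpha>\<in>\<Phi>. \<eta> \<alpha> \<noteq> 0" using image(1) unfolding im[symmetric] root_system_def by blast
  have red: "reduction \<eta> \<Phi> (integral_shell M)"
    using lin nz im span_base[of _ \<Phi>] by (fastforce simp: reduction_def)
  have core: "\<exists>\<Psi>. subsystem \<Psi> \<Phi> \<and> irreducible_system \<Psi> \<and> root_rank \<Psi> = 2 \<and>
      (\<exists>g\<in>functionals \<Psi>. \<gamma> \<in> core \<Psi> g \<and>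
        \<eta> ` positive_roots \<Psi> g \<subseteq> positive_roots (integral_shell M) f \<and>
        \<Psi> \<inter> \<eta> -` span {\<eta> \<gamma>} \<subseteq> span {\<gamma>})"
    if f: "f \<in> functionals (integral_shell M)" and \<gamma>: "\<gamma> \<in> \<Phi>" "\<eta> \<gamma> \<in> core (integral_shell M) f" for f \<gamma>
  proof -
    obtain \<delta> and p q :: "'a \<Rightarrow> real" where d: "\<delta> \<in> \<Phi>" "\<gamma> - \<delta> \<in> \<Phi>" and pq: "linear p" "linear q"
      and pos: "f (\<eta> \<delta>) > 0" "f (\<eta> (\<gamma> - \<delta>)) > 0"
      and ker: "\<And>x. \<eta> x = 0 \<longleftrightarrow> p x = 0 \<and> q x = 0"
      and det: "p \<delta> * q (\<gamma> - \<delta>) \<noteq> p (\<gamma> - \<delta>) * q \<delta>"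
      using core_lift_decomposes[OF \<Theta> M f \<gamma>(2)[unfolded \<eta>_def] \<gamma>(1)] unfolding \<eta>_def by metis
    note ind = independent_by_det[OF pq det]
    show ?thesis
      using good_core[OF lin f[folded im] d _ pos ind(1,2)] ind(3) ker \<gamma>(1) unfolding im by simp
  qed
  have "good_reduction 2 \<eta> \<Phi> (integral_shell M)"
    using red good_kernel[OF lin nz] core unfolding good_reduction_def by auto
  with image show ?thesis by blast
qed

end
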